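(* Suppose that (a) $X=\mathbb L_{\geq 0}$; or (b) $X=\mathbb L$; or (c) $X=\kappa^n\times\lambda_1\times\cdots\times\lambda_j$, where $\kappa$ is an uncountable regular cardinal, $\lambda_1,\dots,\lambda_j$ are successor ordinals smaller than $\kappa$, and $n,j\in\mathbb N$. Then $X$ has the Compactly Supported Homeomorphism Property (CSHP).
   Context: The Closed Long Ray $\mathbb L_{\geq0}$ is $\omega_1\times[0,1)$ with the order topology of the lexicographic order. The Long Line $\mathbb L$ is obtained by gluing a copy of $\mathbb L_{\geq0}$ with the reversed order and a copy with the usual order at their least points $(0,0)$. Ordinals carry the order topology and products the product topology. For a Tychonoff space $X$, the support of a homeomorphism $h$ of $X$ is $\operatorname{cl}_X\{x\mid h(x)\neq x\}$; $\operatorname{Homeo}_{cpt}(X)$ is the group of compactly supported homeomorphisms of $X$. Each such $h$ extends to a homeomorphism of the Stone–Čech compactification $\beta X$ that is the identity on $\beta X\setminus X$, so $\operatorname{Homeo}_{cpt}(X)$ is a subgroup of $\operatorname{Homeo}(\beta X)$, and it is equipped with the compact-open topology induced from $\beta X$. For compact $K\subseteq X$, $\operatorname{Homeo}_K(X)$ is the subgroup of homeomorphisms fixing every point outside $K$, with the subspace topology. $X$ has CSHP if $\operatorname{colim}_{K\in\mathscr K(X)}\operatorname{Homeo}_K(X)=\operatorname{Homeo}_{cpt}(X)$, where the left side is the union $\bigcup_K\operatorname{Homeo}_K(X)$ equipped with the colimit space topology $\{U\mid U\cap\operatorname{Homeo}_K(X)\text{ open in }\operatorname{Homeo}_K(X)\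 \forall K\}$, $\mathscr K(X)$ being the compact subsets of $X$ ordered by inclusion; i.e. this colimit space topology coincides with the topology of $\operatorname{Homeo}_{cpt}(X)$ just described. *)

theory Defs
  imports "HOL-Analysis.Analysis"
begin

text \<open>The order topology on a set S linearly ordered by the strict relation less:
  generated by the open rays (together with S itself, so that the carrier is S).\<close>
definition order_top :: "'a set \<Rightarrow> ('a \<Rightarrow> 'a \<Rightarrow> bool) \<Rightarrow> 'a topology" where
  "order_top S lt = topology_generated_by
     ({S} \<union> {{y \<in> S. lt y a} | a. a \<in> S} \<union> {{y \<in> S. lt a y} | a. a \<in> S})"

text \<open>An ordinal, given as a well-order r, with its order topology on Field r.\<close>
definition ord_top :: "'a rel \<Rightarrow> 'a topology" where
  "ord_top r = order_top (Field r) (\<lambda>x y. (x, y) \<in> r \<and> x \<noteq> y)"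

definition successor_ordinal :: "'a rel \<Rightarrow> bool" where
  "successor_ordinal l \<longleftrightarrow> Well_order l \<and> (\<exists>m \<in> Field l. \<forall>x \<in> Field l. (x, m) \<in> l)"

abbreviation omega1 :: "nat set rel" where
  "omega1 \<equiv> cardSuc natLeq"

definition long_ray_set :: "(nat set \<times> real) set" where
  "long_ray_set = Field omega1 \<times> {0..<1}"

definition long_ray_less :: "nat set \<times> real \<Rightarrow> nat set \<times> real \<Rightarrow> bool" where
  "long_ray_less p q \<longleftrightarrow>
     ((fst p, fst q) \<in> omega1 \<and> fst p \<noteq> fst q) \<or> (fst p = fst q \<and> snd p < snd q)"

definition long_ray :: "(nat set \<times> real) topology" where
  "long_ray = order_top long_ray_set long_ray_less"

definition long_ray_zero :: "nat set \<times> real" where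
  "long_ray_zero = (SOME p. p \<in> long_ray_set \<and> (\<forall>q \<in> long_ray_set. p = q \<or> long_ray_less p q))"

text \<open>The long line: a reversed copy (tagged False) and a usual copy (tagged True) of the long
  ray glued at their least points; the point (0,0) is represented only in the True copy.\<close>
definition long_line_set :: "(bool \<times> (nat set \<times> real)) set" where
  "long_line_set = {(False, p) | p. p \<in> long_ray_set \<and> p \<noteq> long_ray_zero}
                 \<union> {(True, p) | p. p \<in> long_ray_set}"

definition long_line_less :: "bool \<times> (nat set \<times> real) \<Rightarrow> bool \<times> (nat set \<times> real) \<Rightarrow> bool" where
  "long_line_less x y \<longleftrightarrow>
     (\<not> fst x \<and> \<not> fst y \<and> long_ray_less (snd y) (snd x)) \<or>
     (\<not> fst x \<and> fst y) \<or>
     (fst x \<and> fst y \<and> long_ray_less (snd x) (snd y))"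

definition long_line :: "(bool \<times> (nat set \<times> real)) topology" where
  "long_line = order_top long_line_set long_line_less"

text \<open>kappa^n x lambda_1 x ... x lambda_j, as a finite product indexed by {..<n+j};
  coordinates i<n range over kappa (tagged Inl), coordinate n+k over lambda_(k+1) (tagged Inr).\<close>
definition ordinal_product :: "'a rel \<Rightarrow> nat \<Rightarrow> 'b rel list \<Rightarrow> (nat \<Rightarrow> 'a + 'b) topology" where
  "ordinal_product \<kappa> n ls = product_topology
     (\<lambda>i. if i < n then ord_top (map_prod Inl Inl ` \<kappa>)
          else ord_top (map_prod Inr Inr ` (ls ! (i - n)))) {..<n + length ls}"

definition cb_funs :: "'a topology \<Rightarrow> ('a \<Rightarrow> real) set" where
  "cb_funs X = {f. continuous_map X (top_of_set {0..1}) f}"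

definition cube :: "'a topology \<Rightarrow> (('a \<Rightarrow> real) \<Rightarrow> real) topology" where
  "cube X = product_topology (\<lambda>_. top_of_set {0..1}) (cb_funs X)"

definition beta_emb :: "'a topology \<Rightarrow> 'a \<Rightarrow> (('a \<Rightarrow> real) \<Rightarrow> real)" where
  "beta_emb X x = restrict (\<lambda>f. f x) (cb_funs X)"

definition beta :: "'a topology \<Rightarrow> (('a \<Rightarrow> real) \<Rightarrow> real) topology" where
  "beta X = subtopology (cube X) (cube X closure_of (beta_emb X ` topspace X))"

text \<open>The extension of h to beta X: the unique continuous map with ext(e x) = e(h x).\<close>
definition beta_ext :: "'a topology \<Rightarrow> ('a \<Rightarrow> 'a) \<Rightarrow> (('a \<Rightarrow> real) \<Rightarrow> real) \<Rightarrow> (('a \<Rightarrow> real) \<Rightarrow> real)" where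
  "beta_ext X h t = restrict (\<lambda>f. t (f \<circ> h)) (cb_funs X)"

definition Homeo :: "'a topology \<Rightarrow> ('a \<Rightarrow> 'a) set" where
  "Homeo X = {h. homeomorphic_map X X h \<and> (\<forall>x. x \<notin> topspace X \<longrightarrow> h x = x)}"

definition support :: "'a topology \<Rightarrow> ('a \<Rightarrow> 'a) \<Rightarrow> 'a set" where
  "support X h = X closure_of {x \<in> topspace X. h x \<noteq> x}"

definition Homeo_cpt :: "'a topology \<Rightarrow> ('a \<Rightarrow> 'a) set" where
  "Homeo_cpt X = {h \<in> Homeo X. compactin X (support X h)}"

definition Homeo_K :: "'a topology \<Rightarrow> 'a set \<Rightarrow> ('a \<Rightarrow> 'a) set" where
  "Homeo_K X K = {h \<in> Homeo X. \<forall>x \<in> topspace X - K. h x = x}"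

text \<open>Compact-open topology on Homeo_cpt X, induced from Homeo(beta X) via h \<mapsto> beta_ext X h.\<close>
definition Homeo_cpt_top :: "'a topology \<Rightarrow> ('a \<Rightarrow> 'a) topology" where
  "Homeo_cpt_top X = topology_generated_by
     {{h \<in> Homeo_cpt X. beta_ext X h ` C \<subseteq> U} | C U. compactin (beta X) C \<and> openin (beta X) U}"

definition colim_top :: "'a topology \<Rightarrow> ('a \<Rightarrow> 'a) topology" where
  "colim_top X = topology (\<lambda>U. U \<subseteq> (\<Union>K \<in> {K. compactin X K}. Homeo_K X K) \<and>
     (\<forall>K. compactin X K \<longrightarrow>
        openin (subtopology (Homeo_cpt_top X) (Homeo_K X K)) (U \<inter> Homeo_K X K)))"

definition CSHP :: "'a topology \<Rightarrow> bool" where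
  "CSHP X \<longleftrightarrow> (\<Union>K \<in> {K. compactin X K}. Homeo_K X K) = Homeo_cpt X \<and>
                colim_top X = Homeo_cpt_top X"

end

theory Submission
  imports Defs
begin

text \<open>
  Translations are continuous, so only neighbourhoods of the identity matter. Let U contain the
  identity and meet every subgroup of homeomorphisms supported in a compact set in an open set.
  Neighbourhoods of the identity are described by finite sets P of pairs (A, B) of functionally
  separated subsets of X: the homeomorphisms moving no point from A into B or back. If no P gives
  a neighbourhood inside U, choose for each P a homeomorphism outside U that is P-close to the
  identity. The space is a union of compact sets indexed by a regular uncountable cardinal, and
  the pairs used at each index are fewer than the cardinal. So there is a limit index \<beta> such that for
  every P with data below \<beta> the chosen homeomorphism is supported in the \<beta>-th compact set K. The
  pairs below \<beta> separate the points of K, hence, by compactness of the square of K, they describe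
  all neighbourhoods of the identity among homeomorphisms supported in K. One of the chosen
  homeomorphisms then lies in U, a contradiction.
\<close>

section \<open>Extensions to the Stone-Cech compactification\<close>

text \<open>The obstacle is a conflict of sizes. Below a fixed index there are fewer than \<kappa>
  finite sets of pairs, so by regularity the supports chosen for them are bounded, but by a larger
  index, where new pairs appear. Iterating \<omega> times and passing to the supremum \<beta>
  resolves this: \<beta> stays below \<kappa> because the cofinality is uncountable, and a finite
  set of pairs with indices below \<beta> already sits below some stage of the iteration.
  Compactness is what makes the sets finite. The families of pairs are fixed before U is known. A
  pair has to meet two demands: a continuous function separates its members, which makes closeness
  visible in the compactification, and the interiors of its members contain the points to be told
  apart, which yields open covers of the square of K. In each space the pairs are chosen so that
  distinct points of the \<beta>-th compact set are told apart by a pair of index strictly below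
  \<beta>; this governs where the compact sets end.\<close>

lemma cb_funs_comp: "f \<in> cb_funs X \<Longrightarrow> continuous_map X X h \<Longrightarrow> f \<circ> h \<in> cb_funs X"
  unfolding cb_funs_def using continuous_map_compose by blast

lemma Homeo_continuous: "h \<in> Homeo X \<Longrightarrow> continuous_map X X h"
  by (simp add: Homeo_def homeomorphic_imp_continuous_map)

lemma topspace_cube: "topspace (cube X) = cb_funs X \<rightarrow>\<^sub>E {0..1}"
  by (simp add: cube_def)

lemma beta_emb_apply: "f \<in> cb_funs X \<Longrightarrow> beta_emb X x f = f x"
  by (simp add: beta_emb_def)

lemma beta_emb_in_cube: "x \<in> topspace X \<Longrightarrow> beta_emb X x \<in> topspace (cube X)"
  by (auto simp: topspace_cube beta_emb_def cb_funs_def continuous_map_in_subtopology)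

lemma beta_emb_in_beta: "x \<in> topspace X \<Longrightarrow> beta_emb X x \<in> topspace (beta X)"
  using beta_emb_in_cube[of x X]
  unfolding beta_def topspace_subtopology
  by (metis (no_types, lifting) IntI closure_of_subset image_eqI image_subsetI in_mono beta_emb_in_cube)

lemma topspace_beta: "topspace (beta X) = cube X closure_of (beta_emb X ` topspace X)"
  unfolding beta_def topspace_subtopology using closure_of_subset_topspace by fast

lemma beta_extensional: "t \<in> topspace (beta X) \<Longrightarrow> t \<in> extensional (cb_funs X)"
  by (metis PiE_iff beta_def IntD1 topspace_cube topspace_subtopology)

lemma compact_space_beta: "compact_space (beta X)"
proof -
  have "compact_space (cube X)"
    unfolding cube_def
    by (simp add: compact_space_product_topology compact_space_subtopology)
  then show ?thesis
    unfolding beta_def by (simp add: closedin_compact_space compact_space_subtopology)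
qed

lemma Hausdorff_space_beta: "Hausdorff_space (beta X)"
  unfolding beta_def cube_def
  by (simp add: Hausdorff_space_product_topology Hausdorff_space_subtopology)

lemma continuous_map_beta_coordinate:
  assumes "f \<in> cb_funs X"
  shows "continuous_map (beta X) (top_of_set {0..1}) (\<lambda>t. t f)"
  unfolding beta_def cube_def using assms
  by (intro continuous_map_from_subtopology continuous_map_product_projection)

lemma continuous_map_beta_coordinate_real:
  assumes "f \<in> cb_funs X"
  shows "continuous_map (beta X) euclideanreal (\<lambda>t. t f)"
  using continuous_map_beta_coordinate[OF assms] continuous_map_into_fulltopology by blast

lemma closure_of_beta_emb: "beta X closure_of (beta_emb X ` topspace X) = topspace (beta X)"
proof -
  have "beta_emb X ` topspace X \<subseteq> cube X closure_of (beta_emb X ` topspace X)"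
    by (intro closure_of_subset) (auto simp: beta_emb_in_cube)
  then show ?thesis
    unfolding topspace_beta unfolding beta_def by (simp add: closure_of_subtopology Int_absorb1)
qed

text \<open>The embedded copy of the space is dense and the condition is closed. This replaces
  limits of nets when an identity or inequality is carried over to the compactification.\<close>

lemma beta_dense_induct:
  assumes "t \<in> topspace (beta X)" "closedin (beta X) {t \<in> topspace (beta X). P t}"
    and "\<And>x. x \<in> topspace X \<Longrightarrow> P (beta_emb X x)"
  shows "P t"
  using forall_in_closure_of[of t "beta X" "beta_emb X ` topspace X" P] assms
  by (auto simp: closure_of_beta_emb)

lemma beta_ext_emb:
  assumes "continuous_map X X h"
  shows "beta_ext X h (beta_emb X x) = beta_emb X (h x)"
  using cb_funs_comp[OF _ assms] by (auto simp: beta_ext_def beta_emb_def fun_eq_iff restrict_def)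

text \<open>Composition with \<open>h\<close> only reindexes the coordinates of the cube, so
  continuity is visible coordinatewise; the closure of the embedded copy is preserved because
  \<open>h\<close> maps the space into itself.\<close>

lemma continuous_map_beta_ext:
  assumes h: "continuous_map X X h"
  shows "continuous_map (beta X) (beta X) (beta_ext X h)"
proof -
  have cube: "continuous_map (cube X) (cube X) (beta_ext X h)"
    unfolding cube_def continuous_map_componentwise
  proof (intro conjI ballI)
    fix f assume "f \<in> cb_funs X"
    then have "continuous_map (product_topology (\<lambda>_. top_of_set {0..1::real}) (cb_funs X))
                (top_of_set {0..1}) (\<lambda>t. t (f \<circ> h))"
      by (intro continuous_map_product_projection cb_funs_comp h)
    then show "continuous_map (product_topology (\<lambda>_. top_of_set {0..1::real}) (cb_funs X))
                (top_of_set {0..1}) (\<lambda>t. beta_ext X h t f)"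
      by (simp add: beta_ext_def \<open>f \<in> cb_funs X\<close>)
  qed (auto simp: beta_ext_def)
  have "beta_ext X h ` (cube X closure_of (beta_emb X ` topspace X))
      \<subseteq> cube X closure_of (beta_ext X h ` beta_emb X ` topspace X)"
    by (rule continuous_map_image_closure_subset[OF cube])
  also have "\<dots> \<subseteq> cube X closure_of (beta_emb X ` topspace X)"
    using continuous_map_image_subset_topspace[OF h]
    by (intro closure_of_mono) (auto simp: beta_ext_emb[OF h])
  finally show ?thesis
    unfolding beta_def using cube
    by (auto simp: continuous_map_in_subtopology continuous_map_from_subtopology)
qed

lemma beta_ext_in_beta:
  "continuous_map X X h \<Longrightarrow> t \<in> topspace (beta X) \<Longrightarrow> beta_ext X h t \<in> topspace (beta X)"
  using continuous_map_beta_ext continuous_map_image_subset_topspace by fastforce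

lemma beta_ext_comp:
  assumes "continuous_map X X g"
  shows "beta_ext X (g \<circ> h) t = beta_ext X g (beta_ext X h t)"
  using cb_funs_comp[OF _ assms] by (auto simp: beta_ext_def fun_eq_iff comp_assoc)

lemma beta_ext_id: "t \<in> topspace (beta X) \<Longrightarrow> beta_ext X id t = t"
  using beta_extensional[of t X] by (auto simp: beta_ext_def fun_eq_iff extensional_def)

text \<open>Urysohn's lemma in the compactification turns a subbasic neighbourhood of the identity into
  a condition on a single function on the space itself.\<close>
lemma beta_ext_subset_criterion:
  assumes C: "compactin (beta X) C" and U: "openin (beta X) U" and "C \<subseteq> U"
  obtains f where "f \<in> cb_funs X"
    "\<And>h. continuous_map X X h \<Longrightarrow> (\<And>x. x \<in> topspace X \<Longrightarrow> \<bar>f (h x) - f x\<bar> \<le> 1/2)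
          \<Longrightarrow> beta_ext X h ` C \<subseteq> U"
proof -
  have "normal_space (beta X)"
    by (simp add: compact_Hausdorff_or_regular_imp_normal_space compact_space_beta Hausdorff_space_beta)
  moreover have "closedin (beta X) C"
    using C Hausdorff_space_beta compactin_imp_closedin by blast
  moreover have "closedin (beta X) (topspace (beta X) - U)"
    using U by blast
  ultimately obtain \<phi> where \<phi>: "continuous_map (beta X) (top_of_set {0..1::real}) \<phi>"
      and \<phi>0: "\<phi> ` C \<subseteq> {0}" and \<phi>1: "\<phi> ` (topspace (beta X) - U) \<subseteq> {1}"
    using Urysohn_lemma[of "beta X" C "topspace (beta X) - U" 0 1] \<open>C \<subseteq> U\<close>
    by (auto simp: disjnt_iff)
  define f where "f = \<phi> \<circ> beta_emb X"
  have "continuous_map X (cube X) (beta_emb X)"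
    unfolding cube_def continuous_map_componentwise
    by (auto simp: beta_emb_def cb_funs_def)
  then have "continuous_map X (beta X) (beta_emb X)"
    unfolding beta_def
    by (simp add: continuous_map_in_subtopology image_subset_iff closure_of_subset[THEN subsetD] beta_emb_in_cube)
  then have f: "f \<in> cb_funs X"
    unfolding f_def cb_funs_def using \<phi> continuous_map_compose by blast
  have \<phi>real: "continuous_map (beta X) euclideanreal \<phi>"
    using \<phi> continuous_map_into_fulltopology by blast
  \<comment> \<open>Both sides agree on the dense embedded copy. Hence \<phi> is itself a
    coordinate, and its value at \<open>beta_ext X h t\<close> is the coordinate
    \<open>f \<circ> h\<close> of \<open>t\<close>.\<close>
  have \<phi>f: "\<phi> t = t f" if "t \<in> topspace (beta X)" for t
    using that
  proof (rule beta_dense_induct)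
    show "closedin (beta X) {t \<in> topspace (beta X). \<phi> t = t f}"
      by (rule closedin_continuous_maps_eq[where Y=euclideanreal]) (simp_all add: \<phi>real continuous_map_beta_coordinate_real f)
  qed (simp add: beta_emb_apply[OF f], simp add: f_def)
  show ?thesis
  proof (rule that[OF f])
    fix h assume h: "continuous_map X X h" and close: "\<And>x. x \<in> topspace X \<Longrightarrow> \<bar>f (h x) - f x\<bar> \<le> 1/2"
    show "beta_ext X h ` C \<subseteq> U"
    proof clarify
      fix t assume "t \<in> C"
      then have t: "t \<in> topspace (beta X)"
        using C compactin_subset_topspace by blast
      \<comment> \<open>The closeness bound passes to the closure. As \<phi> is 0 on
        \<open>C\<close> and 1 outside \<open>U\<close>, a value of at most 1/2 forces the image
        point into \<open>U\<close>.\<close>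
      have "t (f \<circ> h) - t f \<in> {..1/2}"
        using t
      proof (rule beta_dense_induct)
        have "continuous_map (beta X) euclideanreal (\<lambda>t. t (f \<circ> h) - t f)"
          by (intro continuous_map_diff continuous_map_beta_coordinate_real cb_funs_comp f h)
        from closedin_continuous_map_preimage[OF this, of "{..1/2}"]
        show "closedin (beta X) {t \<in> topspace (beta X). t (f \<circ> h) - t f \<in> {..1/2}}"
          by simp
      next
        fix x assume "x \<in> topspace X"
        then show "beta_emb X x (f \<circ> h) - beta_emb X x f \<in> {..1/2}"
          unfolding beta_emb_apply[OF f] beta_emb_apply[OF cb_funs_comp[OF f h]] atMost_iff comp_apply
          using close[of x] by linarith
      qed
      moreover have "t f = 0"
        using \<phi>0 \<open>t \<in> C\<close> \<phi>f t by auto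
      ultimately have "\<phi> (beta_ext X h t) \<le> 1/2"
        using \<phi>f[OF beta_ext_in_beta[OF h t]] f by (simp add: beta_ext_def)
      then show "beta_ext X h t \<in> U"
        using \<phi>1 beta_ext_in_beta[OF h t] by fastforce
    qed
  qed
qed

section \<open>Compactly supported homeomorphisms\<close>

text \<open>Members of \<open>Homeo X\<close> fix every point outside the carrier, so they are
  permutations of the whole type and the total function \<open>inv h\<close> is the group
  inverse.\<close>

lemma Homeo_bij_inv:
  assumes "h \<in> Homeo X"
  shows "bij h" and "inv h \<in> Homeo X"
proof -
  have out: "\<And>x. x \<notin> topspace X \<Longrightarrow> h x = x" and hom: "homeomorphic_map X X h"
    using assms by (auto simp: Homeo_def)
  obtain g where g: "homeomorphic_maps X X h g"
    using hom unfolding homeomorphic_map_maps by blast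
  have im: "h ` topspace X = topspace X" and inj: "inj_on h (topspace X)"
    using hom by (simp_all add: homeomorphic_eq_everything_map)
  have "inj h"
  proof (rule injI)
    fix x y assume eq: "h x = h y"
    have "z \<in> topspace X \<longleftrightarrow> h z \<in> topspace X" for z
      using im out[of z] by (cases "z \<in> topspace X") auto
    then show "x = y"
      using eq inj out[of x] out[of y] by (metis inj_onD)
  qed
  moreover have "surj h"
  proof -
    have "y \<in> range h" for y
      using im out[of y] by (cases "y \<in> topspace X") (blast, metis rangeI)
    then show ?thesis by blast
  qed
  ultimately show bij: "bij h"
    by (simp add: bij_def)
  have eq: "g x = inv h x" if "x \<in> topspace X" for x
  proof -
    have "h (g x) = x"
      using g that by (simp add: homeomorphic_maps_def)
    then show ?thesis
      using \<open>inj h\<close> inv_f_f by metis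
  qed
  have "homeomorphic_map X X g"
    using g homeomorphic_maps_map by blast
  then have "homeomorphic_map X X (inv h)"
    using homeomorphic_map_eq[of X X g "inv h"] eq by blast
  moreover have "inv h x = x" if "x \<notin> topspace X" for x
    using out[OF that] \<open>inj h\<close> by (simp add: inv_f_eq)
  ultimately show "inv h \<in> Homeo X"
    by (simp add: Homeo_def)
qed

lemma Homeo_comp: "g \<in> Homeo X \<Longrightarrow> h \<in> Homeo X \<Longrightarrow> g \<circ> h \<in> Homeo X"
  unfolding Homeo_def using homeomorphic_map_compose by fastforce

lemma Homeo_cpt_comp:
  assumes "g \<in> Homeo_cpt X" "h \<in> Homeo_cpt X"
  shows "g \<circ> h \<in> Homeo_cpt X"
proof -
  have "support X (g \<circ> h) \<subseteq> X closure_of ({x \<in> topspace X. g x \<noteq> x} \<union> {x \<in> topspace X. h x \<noteq> x})"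
    unfolding support_def by (rule closure_of_mono) auto
  then have "support X (g \<circ> h) \<subseteq> support X g \<union> support X h"
    by (simp add: support_def)
  moreover have "compactin X (support X g \<union> support X h)"
    using assms by (simp add: Homeo_cpt_def compactin_Un)
  moreover have "closedin X (support X (g \<circ> h))"
    by (simp add: support_def)
  ultimately have "compactin X (support X (g \<circ> h))"
    by (metis closed_compactin)
  then show ?thesis
    using assms by (simp add: Homeo_cpt_def Homeo_comp)
qed

lemma Homeo_cpt_inv:
  assumes "g \<in> Homeo_cpt X"
  shows "inv g \<in> Homeo_cpt X"
proof -
  have g: "g \<in> Homeo X"
    using assms by (simp add: Homeo_cpt_def)
  have "inv g x = x \<longleftrightarrow> g x = x" for x
    using bij_inv_eq_iff[OF Homeo_bij_inv(1)[OF g], of x x] by auto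
  then have "support X (inv g) = support X g"
    by (simp add: support_def)
  then show ?thesis
    using assms Homeo_bij_inv(2)[OF g] by (simp add: Homeo_cpt_def)
qed

lemma id_in_Homeo_cpt: "id \<in> Homeo_cpt X"
  by (simp add: Homeo_cpt_def Homeo_def support_def)

text \<open>A value \<open>h x\<close> outside \<open>K\<close> would be a fixed point having the
  same image as \<open>x\<close>, against injectivity.\<close>

lemma Homeo_K_maps_K:
  assumes "h \<in> Homeo_K X K" "K \<subseteq> topspace X" "x \<in> K"
  shows "h x \<in> K"
proof (rule ccontr)
  assume "h x \<notin> K"
  have h: "h \<in> Homeo X" and fix_out: "\<And>x. x \<in> topspace X - K \<Longrightarrow> h x = x"
    using assms(1) by (auto simp: Homeo_K_def)
  have "h x \<in> topspace X"
    using continuous_map_image_subset_topspace[OF Homeo_continuous[OF h]] assms by auto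
  then have "h (h x) = h x"
    using fix_out \<open>h x \<notin> K\<close> by blast
  then have "h x = x"
    using Homeo_bij_inv(1)[OF h] by (meson bij_def inj_eq)
  then show False
    using \<open>h x \<notin> K\<close> \<open>x \<in> K\<close> by simp
qed

lemma Homeo_K_mono: "K \<subseteq> L \<Longrightarrow> Homeo_K X K \<subseteq> Homeo_K X L"
  by (auto simp: Homeo_K_def)

lemma Homeo_K_support:
  assumes "h \<in> Homeo X"
  shows "h \<in> Homeo_K X (support X h)"
proof -
  have "{x \<in> topspace X. h x \<noteq> x} \<subseteq> support X h"
    unfolding support_def by (rule closure_of_subset) blast
  then show ?thesis
    using assms unfolding Homeo_K_def by blast
qed

text \<open>In a Hausdorff space \<open>K\<close> is closed, so the closure of the set of moved
  points stays inside it.\<close>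

lemma Homeo_K_subset_Homeo_cpt:
  assumes "Hausdorff_space X" "compactin X K"
  shows "Homeo_K X K \<subseteq> Homeo_cpt X"
proof
  fix h assume h: "h \<in> Homeo_K X K"
  have "closedin X K"
    using assms by (rule compactin_imp_closedin)
  then have "support X h \<subseteq> K"
    unfolding support_def using h by (intro closure_of_minimal) (auto simp add: Homeo_K_def)
  then have "compactin X (support X h)"
    by (rule closed_compactin[OF assms(2)]) (simp add: support_def)
  then show "h \<in> Homeo_cpt X"
    using h by (simp add: Homeo_cpt_def Homeo_K_def)
qed

lemma Union_Homeo_K:
  assumes "Hausdorff_space X"
  shows "(\<Union>K \<in> {K. compactin X K}. Homeo_K X K) = Homeo_cpt X"
proof
  show "Homeo_cpt X \<subseteq> (\<Union>K \<in> {K. compactin X K}. Homeo_K X K)"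
    using Homeo_K_support unfolding Homeo_cpt_def by blast
  show "(\<Union>K \<in> {K. compactin X K}. Homeo_K X K) \<subseteq> Homeo_cpt X"
    using Homeo_K_subset_Homeo_cpt[OF assms] by blast
qed

section \<open>The group topology, its left translations and the colimit topology\<close>

lemma topspace_Homeo_cpt_top: "topspace (Homeo_cpt_top X) = Homeo_cpt X"
proof -
  have "\<Union>{{h \<in> Homeo_cpt X. beta_ext X h ` C \<subseteq> U} | C U. compactin (beta X) C \<and> openin (beta X) U}
      = Homeo_cpt X" (is "\<Union>?B = _")
  proof
    \<comment> \<open>The condition with \<open>C\<close> and \<open>U\<close> both empty is
      vacuous, so the whole group is itself a subbasic set.\<close>
    have "{h \<in> Homeo_cpt X. beta_ext X h ` {} \<subseteq> {}} \<in> ?B"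
      by (rule CollectI, intro exI conjI) (rule refl compactin_empty openin_empty)+
    then show "Homeo_cpt X \<subseteq> \<Union>?B"
      by (intro Union_upper) simp
  qed blast
  then show ?thesis
    by (simp add: Homeo_cpt_top_def)
qed

lemma openin_Homeo_cpt_top_subbase:
  assumes "compactin (beta X) C" "openin (beta X) U"
  shows "openin (Homeo_cpt_top X) {h \<in> Homeo_cpt X. beta_ext X h ` C \<subseteq> U}"
  unfolding Homeo_cpt_top_def using assms by (intro topology_generated_by_Basis) blast

text \<open>The condition that \<open>g \<circ> h\<close> maps \<open>C\<close> into
  \<open>U\<close> says that \<open>h\<close> maps \<open>C\<close> into the preimage of
  \<open>U\<close> under the extension of \<open>g\<close>; so subbasic sets pull back to subbasic
  sets with the same \<open>C\<close>.\<close>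

lemma continuous_map_left_translation:
  assumes g: "g \<in> Homeo_cpt X"
  shows "continuous_map (Homeo_cpt_top X) (Homeo_cpt_top X) (\<lambda>h. g \<circ> h)"
proof -
  have contg: "continuous_map X X g"
    using g by (simp add: Homeo_cpt_def Homeo_continuous)
  let ?B = "{{h \<in> Homeo_cpt X. beta_ext X h ` C \<subseteq> U} | C U. compactin (beta X) C \<and> openin (beta X) U}"
  have UB: "\<Union>?B = Homeo_cpt X"
    using topspace_Homeo_cpt_top[of X] by (simp add: Homeo_cpt_top_def)
  have "continuous_map (Homeo_cpt_top X) (topology_generated_by ?B) (\<lambda>h. g \<circ> h)"
  proof (rule continuous_on_generated_topo)
    fix W assume "W \<in> ?B"
    then obtain C U where W: "W = {h \<in> Homeo_cpt X. beta_ext X h ` C \<subseteq> U}"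
        and C: "compactin (beta X) C" and U: "openin (beta X) U"
      by blast
    define U' where "U' = {t \<in> topspace (beta X). beta_ext X g t \<in> U}"
    have "openin (beta X) U'"
      unfolding U'_def using continuous_map_beta_ext[OF contg] U openin_continuous_map_preimage by blast
    moreover have "(\<lambda>h. g \<circ> h) -` W \<inter> Homeo_cpt X = {h \<in> Homeo_cpt X. beta_ext X h ` C \<subseteq> U'}"
    proof -
      have "beta_ext X h t \<in> topspace (beta X)" if "h \<in> Homeo_cpt X" "t \<in> C" for h t
        using that C compactin_subset_topspace
        by (intro beta_ext_in_beta) (auto simp: Homeo_cpt_def Homeo_continuous)
      then have "beta_ext X (g \<circ> h) ` C \<subseteq> U \<longleftrightarrow> beta_ext X h ` C \<subseteq> U'" if "h \<in> Homeo_cpt X" for h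
        using that by (simp add: image_subset_iff U'_def beta_ext_comp[OF contg])
      then show ?thesis
        using Homeo_cpt_comp[OF g] by (auto simp only: W vimage_def mem_Collect_eq Int_iff)
    qed
    ultimately show "openin (Homeo_cpt_top X) ((\<lambda>h. g \<circ> h) -` W \<inter> topspace (Homeo_cpt_top X))"
      using openin_Homeo_cpt_top_subbase[OF C] by (simp add: topspace_Homeo_cpt_top)
  next
    show "(\<lambda>h. g \<circ> h) ` topspace (Homeo_cpt_top X) \<subseteq> \<Union>?B"
      unfolding UB using Homeo_cpt_comp[OF g] by (auto simp: topspace_Homeo_cpt_top)
  qed
  then show ?thesis
    unfolding Homeo_cpt_top_def .
qed

lemma openin_left_translation:
  assumes "g \<in> Homeo_cpt X" "openin (Homeo_cpt_top X) V"
  shows "openin (Homeo_cpt_top X) {h \<in> Homeo_cpt X. g \<circ> h \<in> V}"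
  using openin_continuous_map_preimage[OF continuous_map_left_translation[OF assms(1)] assms(2)]
  by (simp add: topspace_Homeo_cpt_top)

text \<open>The constructor \<open>topology\<close> returns the given predicate only if this is
  closed under binary intersections and arbitrary unions; the check makes the definition of
  \<open>colim_top\<close> usable.\<close>

lemma openin_colim_top:
  "openin (colim_top X) U \<longleftrightarrow> U \<subseteq> (\<Union>K \<in> {K. compactin X K}. Homeo_K X K) \<and>
     (\<forall>K. compactin X K \<longrightarrow>
        openin (subtopology (Homeo_cpt_top X) (Homeo_K X K)) (U \<inter> Homeo_K X K))"
proof -
  define H where "H = (\<Union>K \<in> {K. compactin X K}. Homeo_K X K)"
  define Y where "Y K = subtopology (Homeo_cpt_top X) (Homeo_K X K)" for K
  have "istopology (\<lambda>U. U \<subseteq> H \<and> (\<forall>K. compactin X K \<longrightarrow> openin (Y K) (U \<inter> Homeo_K X K)))"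
    unfolding istopology_def
  proof (rule conjI; clarify)
    fix S T assume S: "S \<subseteq> H" "\<forall>K. compactin X K \<longrightarrow> openin (Y K) (S \<inter> Homeo_K X K)"
      and T: "\<forall>K. compactin X K \<longrightarrow> openin (Y K) (T \<inter> Homeo_K X K)"
    have "openin (Y K) (S \<inter> T \<inter> Homeo_K X K)" if "compactin X K" for K
    proof -
      have "S \<inter> T \<inter> Homeo_K X K = (S \<inter> Homeo_K X K) \<inter> (T \<inter> Homeo_K X K)"
        by blast
      then show ?thesis
        using S(2) T that by (simp only: openin_Int)
    qed
    then show "S \<inter> T \<subseteq> H \<and> (\<forall>K. compactin X K \<longrightarrow> openin (Y K) (S \<inter> T \<inter> Homeo_K X K))"
      using S(1) by blast
  next
    fix \<K> assume \<K>: "\<forall>S\<in>\<K>. S \<subseteq> H \<and> (\<forall>K. compactin X K \<longrightarrow> openin (Y K) (S \<inter> Homeo_K X K))"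
    have "openin (Y K) (\<Union>\<K> \<inter> Homeo_K X K)" if "compactin X K" for K
    proof -
      have "openin (Y K) (\<Union>S\<in>\<K>. S \<inter> Homeo_K X K)"
        by (rule openin_Union) (use \<K> that in blast)
      then show ?thesis
        by (simp only: Int_Union2)
    qed
    then show "\<Union>\<K> \<subseteq> H \<and> (\<forall>K. compactin X K \<longrightarrow> openin (Y K) (\<Union>\<K> \<inter> Homeo_K X K))"
      using \<K> by blast
  qed
  from topology_inverse'[OF this] show ?thesis
    unfolding colim_top_def H_def Y_def by simp
qed

text \<open>Each \<open>Homeo_K X K\<close> carries the subspace topology, so the colimit topology
  is finer at once. For the converse, a set open in the colimit topology is translated so that the
  point under consideration becomes the identity.\<close>

lemma CSHP_if_neighbourhoods_of_id:
  assumes X: "Hausdorff_space X"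
    and nbhd: "\<And>U. \<lbrakk>U \<subseteq> Homeo_cpt X; id \<in> U;
        \<And>K. compactin X K \<Longrightarrow> openin (subtopology (Homeo_cpt_top X) (Homeo_K X K)) (U \<inter> Homeo_K X K)\<rbrakk>
        \<Longrightarrow> \<exists>V. openin (Homeo_cpt_top X) V \<and> id \<in> V \<and> V \<subseteq> U"
  shows "CSHP X"
  unfolding CSHP_def
proof
  show "(\<Union>K \<in> {K. compactin X K}. Homeo_K X K) = Homeo_cpt X"
    by (rule Union_Homeo_K[OF X])
  show "colim_top X = Homeo_cpt_top X"
    unfolding topology_eq
  proof (intro allI iffI)
    fix U assume U: "openin (Homeo_cpt_top X) U"
    have "U \<subseteq> Homeo_cpt X"
      using openin_subset[OF U] by (simp only: topspace_Homeo_cpt_top)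
    then show "openin (colim_top X) U"
      unfolding openin_colim_top Union_Homeo_K[OF X] openin_subtopology using U by blast
  next
    fix U assume "openin (colim_top X) U"
    then have U: "U \<subseteq> Homeo_cpt X"
      and UK: "\<And>K. compactin X K \<Longrightarrow> openin (subtopology (Homeo_cpt_top X) (Homeo_K X K)) (U \<inter> Homeo_K X K)"
      unfolding openin_colim_top Union_Homeo_K[OF X] by blast+
    show "openin (Homeo_cpt_top X) U"
    proof (subst openin_subopen, intro ballI)
      fix g assume "g \<in> U"
      then have g: "g \<in> Homeo_cpt X"
        using U by blast
      then have gH: "g \<in> Homeo X" and bij: "bij g"
        using Homeo_bij_inv(1) by (auto simp: Homeo_cpt_def)
      define U' where "U' = {h \<in> Homeo_cpt X. g \<circ> h \<in> U}"
      have "\<exists>V. openin (Homeo_cpt_top X) V \<and> id \<in> V \<and> V \<subseteq> U'"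
      proof (rule nbhd)
        show "id \<in> U'"
          using \<open>g \<in> U\<close> by (simp add: U'_def id_in_Homeo_cpt)
        fix K assume K: "compactin X K"
        \<comment> \<open>Translation by \<open>g\<close> may leave \<open>Homeo_K X K\<close>, but
          it lands in \<open>Homeo_K X L\<close>, where \<open>K\<close> is enlarged by the compact
          support of \<open>g\<close>. Openness at stage \<open>L\<close> therefore pulls back to
          openness at stage \<open>K\<close>.\<close>
        define L where "L = K \<union> support X g"
        have L: "compactin X L"
          using K g by (simp add: L_def Homeo_cpt_def compactin_Un)
        obtain T where T: "openin (Homeo_cpt_top X) T" "U \<inter> Homeo_K X L = T \<inter> Homeo_K X L"
          using UK[OF L] unfolding openin_subtopology by blast
        have "g \<in> Homeo_K X L"
          using Homeo_K_support[OF gH] Homeo_K_mono[of "support X g" L X] unfolding L_def by blast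
        then have comp: "g \<circ> h \<in> Homeo_K X L" if "h \<in> Homeo_K X K" for h
          using that Homeo_comp[OF gH, of h] unfolding Homeo_K_def L_def by auto
        have "U' \<inter> Homeo_K X K = {h \<in> Homeo_cpt X. g \<circ> h \<in> T} \<inter> Homeo_K X K"
          using comp T(2) unfolding U'_def by blast
        then show "openin (subtopology (Homeo_cpt_top X) (Homeo_K X K)) (U' \<inter> Homeo_K X K)"
          unfolding openin_subtopology using openin_left_translation[OF g T(1)] by blast
      qed (auto simp: U'_def)
      then obtain V where V: "openin (Homeo_cpt_top X) V" "id \<in> V" "V \<subseteq> U'"
        by blast
      have "{h \<in> Homeo_cpt X. inv g \<circ> h \<in> V} \<subseteq> U"
      proof clarify
        fix h assume "inv g \<circ> h \<in> V"
        then have "g \<circ> (inv g \<circ> h) \<in> U"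
          using V(3) unfolding U'_def by blast
        moreover have "g \<circ> (inv g \<circ> h) = h"
          by (rule ext) (simp add: bij bij_is_surj surj_f_inv_f)
        ultimately show "h \<in> U"
          by simp
      qed
      moreover have "g \<in> {h \<in> Homeo_cpt X. inv g \<circ> h \<in> V}"
        using g V(2) bij by (simp add: bij_is_inj)
      ultimately show "\<exists>T. openin (Homeo_cpt_top X) T \<and> g \<in> T \<and> T \<subseteq> U"
        using openin_left_translation[OF Homeo_cpt_inv[OF g] V(1)] by blast
    qed
  qed
qed

text \<open>A finite set of functionally separated pairs plays the role of an entourage of the
  compactification: a homeomorphism is close to the identity if it moves no point from one member
  of a pair into the other.\<close>
definition near_id :: "'a topology \<Rightarrow> ('a set \<times> 'a set) set \<Rightarrow> ('a \<Rightarrow> 'a) \<Rightarrow> bool" where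
  "near_id X P h \<longleftrightarrow> (\<forall>(A, B) \<in> P. \<forall>x \<in> topspace X. (x \<in> A \<longrightarrow> h x \<notin> B) \<and> (x \<in> B \<longrightarrow> h x \<notin> A))"

text \<open>This ensures that the traces of \<open>A\<close> and \<open>B\<close> on the space have
  disjoint closures in the compactification.\<close>

definition functionally_separated :: "'a topology \<Rightarrow> 'a set \<Rightarrow> 'a set \<Rightarrow> bool" where
  "functionally_separated X A B \<longleftrightarrow>
     (\<exists>f \<in> cb_funs X. \<forall>x \<in> topspace X. (x \<in> A \<longrightarrow> f x = 0) \<and> (x \<in> B \<longrightarrow> f x = 1))"

text \<open>One half of the comparison between pairs and the group topology. It concerns the whole
  group and not just one \<open>Homeo_K X K\<close>, so a homeomorphism outside a bad set can be
  chosen before its support is known.\<close>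

lemma near_id_neighbourhood:
  assumes "finite P" "\<And>A B. (A, B) \<in> P \<Longrightarrow> functionally_separated X A B"
  shows "\<exists>V. openin (Homeo_cpt_top X) V \<and> id \<in> V \<and> (\<forall>h \<in> V. near_id X P h)"
  using assms
proof (induction P rule: finite_induct)
  case empty
  show ?case
    by (intro exI[of _ "topspace (Homeo_cpt_top X)"] conjI openin_topspace ballI)
       (simp_all only: topspace_Homeo_cpt_top id_in_Homeo_cpt, simp add: near_id_def)
next
  case (insert p P)
  obtain A B where p: "p = (A, B)" by fastforce
  obtain V where V: "openin (Homeo_cpt_top X) V" "id \<in> V" "\<forall>h \<in> V. near_id X P h"
    using insert.IH[OF insert.prems[OF insertI2]] by blast
  obtain f where f: "f \<in> cb_funs X" and fA: "\<And>x. x \<in> topspace X \<Longrightarrow> x \<in> A \<Longrightarrow> f x = 0"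
      and fB: "\<And>x. x \<in> topspace X \<Longrightarrow> x \<in> B \<Longrightarrow> f x = 1"
    using insert.prems[of A B] unfolding p functionally_separated_def by blast
  \<comment> \<open>\<open>C c\<close> is the compact level set of the coordinate \<open>f\<close>
    in the compactification and \<open>O' c\<close> its open complement. Membership in
    \<open>W a b\<close> forbids moving level \<open>a\<close> into level \<open>b\<close>; the pair
    is controlled by \<open>W 0 1\<close> and \<open>W 1 0\<close> together.\<close>
  define C where "C c = {t \<in> topspace (beta X). t f \<in> {c}}" for c
  define O' where "O' c = {t \<in> topspace (beta X). t f \<in> - {c}}" for c
  define W where "W a b = {h \<in> Homeo_cpt X. beta_ext X h ` C a \<subseteq> O' b}" for a b
  have "closedin (beta X) (C c)" for c
    unfolding C_def by (rule closedin_continuous_map_preimage[OF continuous_map_beta_coordinate_real[OF f]]) simp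
  then have C: "compactin (beta X) (C c)" for c
    using compact_space_beta closedin_compact_space by blast
  have O: "openin (beta X) (O' c)" for c
    unfolding O'_def by (rule openin_continuous_map_preimage[OF continuous_map_beta_coordinate_real[OF f]]) auto
  have W: "openin (Homeo_cpt_top X) (W a b)" for a b
    unfolding W_def by (rule openin_Homeo_cpt_top_subbase[OF C O])
  have idW: "id \<in> W a b" if "a \<noteq> b" for a b
    using that by (auto simp: W_def id_in_Homeo_cpt C_def O'_def beta_ext_id)
  have Wf: "f (h x) \<noteq> b" if "h \<in> W a b" "x \<in> topspace X" "f x = a" for h x a b
  proof -
    have "beta_emb X x \<in> C a"
      using that by (simp add: C_def beta_emb_in_beta beta_emb_apply[OF f])
    then have "beta_ext X h (beta_emb X x) \<in> O' b"
      using that by (auto simp: W_def)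
    moreover have "continuous_map X X h"
      using that by (simp add: W_def Homeo_cpt_def Homeo_continuous)
    ultimately show ?thesis
      by (simp add: O'_def beta_ext_emb beta_emb_apply[OF f])
  qed
  have "near_id X (insert p P) h" if h: "h \<in> V \<inter> W 0 1 \<inter> W 1 0" for h
  proof -
    have "h x \<in> topspace X" if "x \<in> topspace X" for x
      using h that continuous_map_image_subset_topspace[OF Homeo_continuous[of h X]]
      by (auto simp: W_def Homeo_cpt_def)
    then have "(x \<in> A \<longrightarrow> h x \<notin> B) \<and> (x \<in> B \<longrightarrow> h x \<notin> A)" if "x \<in> topspace X" for x
      using that h Wf[of h 0 1 x] Wf[of h 1 0 x] fA[of x] fB[of x] fA[of "h x"] fB[of "h x"] by blast
    moreover have "near_id X P h"
      using h V(3) by blast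
    ultimately show ?thesis
      unfolding near_id_def p by blast
  qed
  moreover have "openin (Homeo_cpt_top X) (V \<inter> W 0 1 \<inter> W 1 0)"
    by (intro openin_Int V W)
  ultimately show ?case
    using V(2) idW[OF zero_neq_one] idW[OF one_neq_zero]
    by (intro exI[of _ "V \<inter> W 0 1 \<inter> W 1 0"] conjI ballI) blast+
qed

text \<open>Interiors are used so that the pairs give open boxes in the square of the space. The two
  orders are allowed because \<open>near_id\<close> is symmetric in \<open>A\<close> and
  \<open>B\<close>.\<close>

definition interior_separated :: "'a topology \<Rightarrow> 'a \<Rightarrow> 'a \<Rightarrow> 'a set \<Rightarrow> 'a set \<Rightarrow> bool" where
  "interior_separated X x y A B \<longleftrightarrow>
     x \<in> X interior_of A \<and> y \<in> X interior_of B \<or> x \<in> X interior_of B \<and> y \<in> X interior_of A"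

text \<open>The points of the square of \<open>K\<close> between which \<open>f\<close> changes by
  at least 1/2 form a compact set off the diagonal, so finitely many boxes from \<C> cover it. A
  homeomorphism supported in \<open>K\<close> has \<open>(x, h x)\<close> in that square for
  \<open>x\<close> in \<open>K\<close>, and closeness to the identity keeps the point out of every
  box.\<close>

lemma near_id_uniform:
  assumes K: "compactin X K"
    and sep: "\<And>x y. x \<in> K \<Longrightarrow> y \<in> K \<Longrightarrow> x \<noteq> y \<Longrightarrow> \<exists>(A, B) \<in> \<C>. interior_separated X x y A B"
    and f: "f \<in> cb_funs X"
  obtains P where "finite P" "P \<subseteq> \<C>"
    "\<And>h x. h \<in> Homeo_K X K \<Longrightarrow> near_id X P h \<Longrightarrow> x \<in> topspace X \<Longrightarrow> \<bar>f (h x) - f x\<bar> \<le> 1/2"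
proof -
  let ?XX = "prod_topology X X"
  \<comment> \<open>The non-strict bound makes \<open>Z\<close> closed in the square of
    \<open>K\<close>; being positive, it also keeps \<open>Z\<close> off the diagonal, where \<C>
    says nothing.\<close>
  define Z where "Z = (K \<times> K) \<inter> {z \<in> topspace ?XX. \<bar>f (snd z) - f (fst z)\<bar> \<in> {1/2..}}"
  have Ktop: "K \<subseteq> topspace X"
    using K compactin_subset_topspace by blast
  have fr: "continuous_map X euclideanreal f"
    using f unfolding cb_funs_def using continuous_map_into_fulltopology by blast
  have "continuous_map ?XX euclideanreal (\<lambda>z. \<bar>f (snd z) - f (fst z)\<bar>)"
    by (intro continuous_map_real_abs continuous_map_diff continuous_map_compose[OF _ fr, unfolded o_def]
        continuous_map_fst continuous_map_snd)
  then have "closedin ?XX {z \<in> topspace ?XX. \<bar>f (snd z) - f (fst z)\<bar> \<in> {1/2..}}"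
    by (rule closedin_continuous_map_preimage) simp
  then have Z: "compactin ?XX Z"
    unfolding Z_def using K by (intro compact_Int_closedin) (simp_all add: compactin_Times)
  define N where "N = (\<lambda>(A, B). ((X interior_of A) \<times> (X interior_of B)) \<union> ((X interior_of B) \<times> (X interior_of A)))"
  have "openin ?XX (N p)" for p
    by (cases p) (auto simp: N_def openin_prod_Times_iff)
  moreover have "Z \<subseteq> \<Union>(N ` \<C>)"
  proof
    fix z assume "z \<in> Z"
    then obtain x y where "z = (x, y)" "x \<in> K" "y \<in> K" and *: "\<bar>f y - f x\<bar> \<ge> 1/2"
      by (auto simp: Z_def)
    moreover from * have "x \<noteq> y"
      by auto
    ultimately show "z \<in> \<Union>(N ` \<C>)"
      using sep[of x y] unfolding N_def interior_separated_def by blast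
  qed
  ultimately obtain \<F> where \<F>: "finite \<F>" "\<F> \<subseteq> N ` \<C>" "Z \<subseteq> \<Union>\<F>"
    using compactinD[OF Z, of "N ` \<C>"] by blast
  then obtain P where P: "finite P" "P \<subseteq> \<C>" "\<F> = N ` P"
    by (meson finite_subset_image)
  show ?thesis
  proof (rule that[OF P(1,2)])
    fix h x assume h: "h \<in> Homeo_K X K" and near: "near_id X P h" and x: "x \<in> topspace X"
    show "\<bar>f (h x) - f x\<bar> \<le> 1/2"
    proof (rule ccontr)
      assume *: "\<not> ?thesis"
      have "x \<in> K"
      proof (rule ccontr)
        assume "x \<notin> K"
        then have "h x = x"
          using h x by (simp add: Homeo_K_def)
        then show False
          using * by simp
      qed
      then have "h x \<in> K"
        using Homeo_K_maps_K[OF h Ktop] by blast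
      then have "(x, h x) \<in> Z"
        using * \<open>x \<in> K\<close> Ktop by (auto simp: Z_def)
      then obtain p where "p \<in> P" "(x, h x) \<in> N p"
        using \<F>(3) P(3) by blast
      then obtain A B where AB: "(A, B) \<in> P" and N: "(x, h x) \<in> N (A, B)"
        by (metis surj_pair)
      have "(x \<in> A \<longrightarrow> h x \<notin> B) \<and> (x \<in> B \<longrightarrow> h x \<notin> A)"
        using near[unfolded near_id_def, THEN bspec, OF AB] x by simp
      then show False
        using N interior_of_subset[of X A] interior_of_subset[of X B] unfolding N_def by auto
    qed
  qed
qed

text \<open>The other half of the comparison, for homeomorphisms supported in one compact set. Along
  the generation of the open set, intersections take the union of the two finite sets of pairs, and
  a subbasic set reduces to a single function by Urysohn's lemma.\<close>

lemma near_id_neighbourhood_base: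
  assumes X: "Hausdorff_space X" and K: "compactin X K"
    and sep: "\<And>x y. x \<in> K \<Longrightarrow> y \<in> K \<Longrightarrow> x \<noteq> y \<Longrightarrow> \<exists>(A, B) \<in> \<C>. interior_separated X x y A B"
    and T: "openin (Homeo_cpt_top X) T" "id \<in> T"
  shows "\<exists>P. finite P \<and> P \<subseteq> \<C> \<and> (\<forall>h \<in> Homeo_K X K. near_id X P h \<longrightarrow> h \<in> T)"
proof -
  have "generate_topology_on
     {{h \<in> Homeo_cpt X. beta_ext X h ` C \<subseteq> U} | C U. compactin (beta X) C \<and> openin (beta X) U} T"
    using T(1) unfolding Homeo_cpt_top_def by (rule openin_topology_generated_by)
  then show ?thesis
    using T(2)
  proof induction
    case (Int S T)
    then obtain P Q where "finite P" "P \<subseteq> \<C>" "\<forall>h \<in> Homeo_K X K. near_id X P h \<longrightarrow> h \<in> S"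
       "finite Q" "Q \<subseteq> \<C>" "\<forall>h \<in> Homeo_K X K. near_id X Q h \<longrightarrow> h \<in> T"
      by auto
    then show ?case
      by (intro exI[of _ "P \<union> Q"]) (auto simp: near_id_def)
  next
    case (UN \<K>)
    then obtain S where "S \<in> \<K>" "id \<in> S" by blast
    then show ?case
      using UN.IH[of S] by blast
  next
    case (Basis S)
    then obtain C U where S: "S = {h \<in> Homeo_cpt X. beta_ext X h ` C \<subseteq> U}"
        and C: "compactin (beta X) C" and U: "openin (beta X) U"
      by blast
    have "C \<subseteq> U"
    proof
      fix t assume "t \<in> C"
      then have "beta_ext X id t \<in> U"
        using Basis(2) unfolding S by blast
      then show "t \<in> U"
        using \<open>t \<in> C\<close> compactin_subset_topspace[OF C] beta_ext_id[of t X] by auto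
    qed
    then obtain f where f: "f \<in> cb_funs X"
      "\<And>h. continuous_map X X h \<Longrightarrow> (\<And>x. x \<in> topspace X \<Longrightarrow> \<bar>f (h x) - f x\<bar> \<le> 1/2)
            \<Longrightarrow> beta_ext X h ` C \<subseteq> U"
      using beta_ext_subset_criterion[OF C U] by blast
    obtain P where P: "finite P" "P \<subseteq> \<C>"
      "\<And>h x. h \<in> Homeo_K X K \<Longrightarrow> near_id X P h \<Longrightarrow> x \<in> topspace X \<Longrightarrow> \<bar>f (h x) - f x\<bar> \<le> 1/2"
      using near_id_uniform[OF K sep f(1)] by blast
    have "h \<in> S" if "h \<in> Homeo_K X K" "near_id X P h" for h
    proof -
      have "h \<in> Homeo_cpt X"
        using that Homeo_K_subset_Homeo_cpt[OF X K] by blast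
      moreover have "beta_ext X h ` C \<subseteq> U"
        using that P(3) by (intro f(2)) (auto simp: Homeo_K_def Homeo_continuous)
      ultimately show ?thesis
        by (simp add: S)
    qed
    then show ?case
      using P by blast
  qed simp
qed

unbundle cardinal_syntax


section \<open>Regular uncountable cardinals and the criterion\<close>

text \<open>A set with \<open>n + 1\<close> elements arises by inserting one element into a set with
  \<open>n\<close>, so stability bounds each level \<open>L n\<close> in turn, and then the union of
  the countably many levels. The argument treats finite and infinite \<open>A\<close> alike.\<close>

lemma card_of_finite_subsets_less:
  assumes stable: "stable \<kappa>" and nat: "|UNIV :: nat set| <o \<kappa>" and A: "|A| <o \<kappa>"
  shows "|{P. finite P \<and> P \<subseteq> A}| <o \<kappa>"
proof -
  define L where "L n = {P. finite P \<and> P \<subseteq> A \<and> card P = n}" for n :: nat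
  have "|L n| <o \<kappa>" for n
  proof (induction n)
    case 0
    have "L 0 \<subseteq> (\<lambda>_. {}) ` (UNIV :: nat set)"
      by (auto simp: L_def)
    then have "|L 0| \<le>o |UNIV :: nat set|"
      by (meson card_of_image card_of_mono1 ordLeq_transitive)
    then show ?case
      using nat ordLeq_ordLess_trans by blast
  next
    case (Suc n)
    have "L (Suc n) \<subseteq> (\<Union>a\<in>A. insert a ` L n)"
    proof
      fix P assume "P \<in> L (Suc n)"
      then have P: "finite P" "P \<subseteq> A" "card P = Suc n"
        by (auto simp: L_def)
      then obtain a where "a \<in> P"
        by fastforce
      then have "P = insert a (P - {a})" "P - {a} \<in> L n" "a \<in> A"
        using P by (auto simp: L_def)
      then show "P \<in> (\<Union>a\<in>A. insert a ` L n)"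
        by blast
    qed
    moreover have "|\<Union>a\<in>A. insert a ` L n| <o \<kappa>"
      using Suc by (intro stable_UNION[OF stable A]) (meson card_of_image ordLeq_ordLess_trans)
    ultimately show ?case
      by (meson card_of_mono1 ordLeq_ordLess_trans)
  qed
  then have "|\<Union>n\<in>UNIV. L n| <o \<kappa>"
    by (intro stable_UNION[OF stable nat]) auto
  moreover have "{P. finite P \<and> P \<subseteq> A} = (\<Union>n\<in>UNIV. L n)"
    by (auto simp: L_def)
  ultimately show ?thesis
    by simp
qed

section \<open>A regular uncountable cardinal as index set\<close>

locale regular_uncountable =
  fixes \<kappa> :: "'k rel"
  assumes card_order: "Card_order \<kappa>" and regular: "regularCard \<kappa>"
    and uncountable: "\<not> countable (Field \<kappa>)"
begin

abbreviation lt :: "'k \<Rightarrow> 'k \<Rightarrow> bool" where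
  "lt a b \<equiv> (a, b) \<in> \<kappa> \<and> a \<noteq> b"

lemma wo_rel: "wo_rel \<kappa>"
  using card_order card_order_on_well_order_on wo_rel_def by blast

lemma infinite_Field: "infinite (Field \<kappa>)"
  using uncountable countable_finite by blast

lemma le_total: "a \<in> Field \<kappa> \<Longrightarrow> b \<in> Field \<kappa> \<Longrightarrow> (a, b) \<in> \<kappa> \<or> lt b a"
  using wo_rel.TOTALS[OF wo_rel] wo_rel.REFL[OF wo_rel] by (metis refl_on_def)

lemma le_refl: "a \<in> Field \<kappa> \<Longrightarrow> (a, a) \<in> \<kappa>"
  using wo_rel.REFL[OF wo_rel] by (metis refl_on_def)

lemma le_trans: "(a, b) \<in> \<kappa> \<Longrightarrow> (b, c) \<in> \<kappa> \<Longrightarrow> (a, c) \<in> \<kappa>"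
  using wo_rel.TRANS[OF wo_rel] by (meson transD)

lemma le_antisym: "(a, b) \<in> \<kappa> \<Longrightarrow> (b, a) \<in> \<kappa> \<Longrightarrow> a = b"
  using wo_rel.ANTISYM[OF wo_rel] by (meson antisymD)

lemma less_le_trans: "lt a b \<Longrightarrow> (b, c) \<in> \<kappa> \<Longrightarrow> lt a c"
  using le_trans le_antisym by blast

lemma in_Field: "(a, b) \<in> \<kappa> \<Longrightarrow> a \<in> Field \<kappa> \<and> b \<in> Field \<kappa>"
  by (auto intro: FieldI1 FieldI2)

lemma exists_greater: "a \<in> Field \<kappa> \<Longrightarrow> \<exists>b. lt a b"
  using infinite_Card_order_limit[OF card_order infinite_Field] by blast

lemma least_exists:
  assumes "A \<subseteq> Field \<kappa>" "A \<noteq> {}"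
  shows "\<exists>m \<in> A. \<forall>a \<in> A. (m, a) \<in> \<kappa>"
  using wo_rel.minim_in[OF wo_rel assms] wo_rel.minim_least[OF wo_rel assms(1)] by blast

lemma stable: "stable \<kappa>"
  by (rule regularCard_stable[OF card_order infinite_Field regular])

lemma card_of_countable_less:
  assumes "countable A"
  shows "|A| <o \<kappa>"
proof -
  have "\<not> \<kappa> \<le>o |A|"
  proof
    assume "\<kappa> \<le>o |A|"
    then have "|Field \<kappa>| \<le>o |A|"
      using card_of_Field_ordIso[OF card_order] ordIso_ordLeq_trans by blast
    then show False
      using uncountable assms by (metis card_of_ordLeq countable_image_inj_on countable_subset)
  qed
  then show ?thesis
    using card_order card_of_Well_order by (metis Card_order_iff_ordLeq_card_of card_order_on_well_order_on not_ordLeq_iff_ordLess)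
qed

lemma card_of_under_less:
  assumes "a \<in> Field \<kappa>"
  shows "|under \<kappa> a| <o \<kappa>"
proof -
  have "|underS \<kappa> a \<union> {a}| <o \<kappa>"
    by (rule card_of_Un_ordLess_infinite_Field[OF infinite_Field card_order card_of_underS[OF card_order assms]])
       (simp add: card_of_countable_less)
  moreover have "under \<kappa> a \<subseteq> underS \<kappa> a \<union> {a}"
    by (auto simp: under_def underS_def)
  ultimately show ?thesis
    by (meson card_of_mono1 ordLeq_ordLess_trans)
qed

text \<open>A cofinal subset of a regular cardinal has full size. A smaller set is thus not cofinal,
  and linearity turns this into a bound.\<close>

lemma bounded_if_small:
  assumes "B \<subseteq> Field \<kappa>" "|B| <o \<kappa>"
  shows "\<exists>c \<in> Field \<kappa>. \<forall>b \<in> B. (b, c) \<in> \<kappa>"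
proof -
  have "\<not> cofinal B \<kappa>"
    using assms regular not_ordLess_ordIso unfolding regularCard_def by blast
  then show ?thesis
    using assms(1) le_total unfolding cofinal_def by (metis subsetD)
qed

text \<open>The least upper bound of the iterates of \<open>G\<close> exists because a countable set
  is bounded in \<kappa>. By leastness, everything below \<open>b\<close> is overtaken by some
  iterate, and applying \<open>G\<close> to that iterate stays below \<open>b\<close>.\<close>

lemma closure_point:
  assumes "\<And>a. a \<in> Field \<kappa> \<Longrightarrow> lt a (G a)"
  obtains s :: "nat \<Rightarrow> 'k" and b where "\<And>n. s (Suc n) = G (s n)" "\<And>n. lt (s n) b"
    "\<And>a. lt a b \<Longrightarrow> \<exists>n. (a, s n) \<in> \<kappa>"
proof -
  obtain a0 where "a0 \<in> Field \<kappa>"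
    using infinite_Field by fastforce
  define s where "s n = (G ^^ n) a0" for n
  have sF: "s n \<in> Field \<kappa>" for n
    by (induction n) (use \<open>a0 \<in> Field \<kappa>\<close> assms in_Field in \<open>auto simp: s_def\<close>)
  have lt_s: "lt (s n) (s (Suc n))" for n
    using assms[OF sF] by (simp add: s_def)
  have "|range s| <o \<kappa>"
    by (simp add: card_of_countable_less)
  then have "{c \<in> Field \<kappa>. \<forall>n. (s n, c) \<in> \<kappa>} \<noteq> {}"
    using bounded_if_small[of "range s"] sF by blast
  then obtain b where b: "b \<in> Field \<kappa>" "\<And>n. (s n, b) \<in> \<kappa>"
      and least: "\<And>c. c \<in> Field \<kappa> \<Longrightarrow> (\<And>n. (s n, c) \<in> \<kappa>) \<Longrightarrow> (b, c) \<in> \<kappa>"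
    using least_exists[of "{c \<in> Field \<kappa>. \<forall>n. (s n, c) \<in> \<kappa>}"] by blast
  show ?thesis
  proof
    show "s (Suc n) = G (s n)" for n
      by (simp add: s_def)
    show "lt (s n) b" for n
      using lt_s[of n] b(2)[of "Suc n"] less_le_trans by blast
    show "\<exists>n. (a, s n) \<in> \<kappa>" if "lt a b" for a
    proof (rule ccontr)
      assume "\<nexists>n. (a, s n) \<in> \<kappa>"
      then have "(s n, a) \<in> \<kappa>" for n
        using le_total[of a "s n"] in_Field that sF by blast
      then have "(b, a) \<in> \<kappa>"
        using least in_Field that by blast
      then show False
        using that le_antisym by blast
    qed
  qed
qed

text \<open>The two separation hypotheses face opposite ways: \<open>funsep\<close> turns closeness
  to the identity into a neighbourhood in the group, \<open>intsep\<close> provides the open boxes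
  covering the square of \<open>K b\<close>. The index in \<open>intsep\<close> lies strictly below
  \<open>b\<close>, since only families of earlier indices have been absorbed at the limit; the
  least index, with no family below it, is excluded.\<close>

theorem CSHP_criterion:
  fixes X :: "'a topology" and K :: "'k \<Rightarrow> 'a set" and \<C> :: "'k \<Rightarrow> ('a set \<times> 'a set) set"
  assumes X: "Hausdorff_space X"
    and compact: "\<And>a. a \<in> Field \<kappa> \<Longrightarrow> compactin X (K a)"
    and mono: "\<And>a b. (a, b) \<in> \<kappa> \<Longrightarrow> K a \<subseteq> K b"
    and cofinal: "\<And>L. compactin X L \<Longrightarrow> \<exists>a \<in> Field \<kappa>. L \<subseteq> K a"
    and small: "\<And>a. a \<in> Field \<kappa> \<Longrightarrow> |\<C> a| <o \<kappa>"
    and funsep: "\<And>a A B. a \<in> Field \<kappa> \<Longrightarrow> (A, B) \<in> \<C> a \<Longrightarrow> functionally_separated X A B"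
    and intsep: "\<And>b x y. (\<exists>a. lt a b) \<Longrightarrow> x \<in> K b \<Longrightarrow> y \<in> K b \<Longrightarrow> x \<noteq> y \<Longrightarrow>
        \<exists>a. lt a b \<and> (\<exists>(A, B) \<in> \<C> a. interior_separated X x y A B)"
  shows "CSHP X"
proof (rule CSHP_if_neighbourhoods_of_id[OF X])
  fix U assume U: "U \<subseteq> Homeo_cpt X" "id \<in> U"
    and UK: "\<And>K. compactin X K \<Longrightarrow> openin (subtopology (Homeo_cpt_top X) (Homeo_K X K)) (U \<inter> Homeo_K X K)"
  \<comment> \<open>The families \<open>\<C> a\<close> are not assumed to increase with
    \<open>a\<close>, so their unions up to \<open>a\<close> are used.\<close>
  define \<C>u where "\<C>u a = (\<Union>c \<in> under \<kappa> a. \<C> c)" for a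
  have \<C>u_mono: "\<C>u a \<subseteq> \<C>u c" if "(a, c) \<in> \<kappa>" for a c
    using le_trans[OF _ that] unfolding \<C>u_def under_def by blast
  define Q where "Q = {P. finite P \<and> P \<subseteq> (\<Union>a \<in> Field \<kappa>. \<C> a)}"
  show "\<exists>V. openin (Homeo_cpt_top X) V \<and> id \<in> V \<and> V \<subseteq> U"
  proof (rule ccontr)
    assume none: "\<not> ?thesis"
    have "\<exists>h a. h \<in> Homeo_K X (K a) \<and> a \<in> Field \<kappa> \<and> near_id X P h \<and> h \<notin> U" if P: "P \<in> Q" for P
    proof -
      obtain V where V: "openin (Homeo_cpt_top X) V" "id \<in> V" "\<forall>h \<in> V. near_id X P h"
        using near_id_neighbourhood[of P X] P funsep unfolding Q_def by blast
      then obtain h where h: "h \<in> V" "h \<notin> U"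
        using none by blast
      then have "h \<in> Homeo_cpt X"
        using openin_subset[OF V(1)] by (auto simp: topspace_Homeo_cpt_top)
      then obtain a where "a \<in> Field \<kappa>" "support X h \<subseteq> K a" "h \<in> Homeo X"
        using cofinal by (auto simp: Homeo_cpt_def)
      then show ?thesis
        using h V(3) Homeo_K_support Homeo_K_mono by blast
    qed
    then obtain h b where h: "\<And>P. P \<in> Q \<Longrightarrow> h P \<in> Homeo_K X (K (b P))" "\<And>P. P \<in> Q \<Longrightarrow> b P \<in> Field \<kappa>"
        "\<And>P. P \<in> Q \<Longrightarrow> near_id X P (h P)" "\<And>P. P \<in> Q \<Longrightarrow> h P \<notin> U"
      by metis
    \<comment> \<open>There are fewer than \<kappa> finite sets of pairs up to index
      \<open>a\<close>, so the indices \<open>b P\<close> of their supports have a common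
      bound.\<close>
    have "\<exists>c. lt a c \<and> (\<forall>P. finite P \<and> P \<subseteq> \<C>u a \<longrightarrow> (b P, c) \<in> \<kappa>)" if a: "a \<in> Field \<kappa>" for a
    proof -
      let ?F = "{P. finite P \<and> P \<subseteq> \<C>u a}"
      have "?F \<subseteq> Q"
        using in_Field by (fastforce simp: Q_def \<C>u_def under_def)
      have "|\<C>u a| <o \<kappa>"
        unfolding \<C>u_def
        by (rule stable_UNION[OF stable card_of_under_less[OF a]])
           (use small in_Field in \<open>auto simp: under_def\<close>)
      then have "|?F| <o \<kappa>"
        by (rule card_of_finite_subsets_less[OF stable card_of_countable_less[OF countableI_type]])
      then have "|b ` ?F| <o \<kappa>"
        using card_of_image ordLeq_ordLess_trans by blast
      moreover have "b ` ?F \<subseteq> Field \<kappa>"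
        using h(2) \<open>?F \<subseteq> Q\<close> by blast
      ultimately have "\<exists>c \<in> Field \<kappa>. \<forall>d \<in> b ` ?F. (d, c) \<in> \<kappa>"
        by (intro bounded_if_small)
      then obtain c where c: "c \<in> Field \<kappa>" "\<And>P. finite P \<Longrightarrow> P \<subseteq> \<C>u a \<Longrightarrow> (b P, c) \<in> \<kappa>"
        by auto
      \<comment> \<open>\<open>d\<close> makes the step strict; the larger of \<open>c\<close> and
        \<open>d\<close> becomes the next index.\<close>
      obtain d where d: "lt a d"
        using exists_greater[OF a] by blast
      show ?thesis
      proof (cases "(c, d) \<in> \<kappa>")
        case True
        show ?thesis
          using d le_trans[OF c(2) True] by (intro exI[of _ d]) simp
      next
        case False
        then have "(d, c) \<in> \<kappa>"
          using le_total[OF c(1)] in_Field d by blast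
        then have "lt a c"
          by (rule less_le_trans[OF d])
        then show ?thesis
          using c(2) by (intro exI[of _ c]) simp
      qed
    qed
    then have "\<exists>G. \<forall>a \<in> Field \<kappa>. lt a (G a) \<and> (\<forall>P. finite P \<and> P \<subseteq> \<C>u a \<longrightarrow> (b P, G a) \<in> \<kappa>)"
      by (intro bchoice ballI)
    then obtain G where G: "\<And>a. a \<in> Field \<kappa> \<Longrightarrow> lt a (G a)"
        "\<And>a P. a \<in> Field \<kappa> \<Longrightarrow> finite P \<Longrightarrow> P \<subseteq> \<C>u a \<Longrightarrow> (b P, G a) \<in> \<kappa>"
      by auto
    obtain s \<beta> where s: "\<And>n. s (Suc n) = G (s n)" "\<And>n. lt (s n) \<beta>"
        "\<And>a. lt a \<beta> \<Longrightarrow> \<exists>n. (a, s n) \<in> \<kappa>"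
      using closure_point[OF G(1)] by metis
    have \<beta>: "\<beta> \<in> Field \<kappa>" and sF: "\<And>n. s n \<in> Field \<kappa>"
      using s(2) in_Field by blast+
    define \<D> where "\<D> = (\<Union>a \<in> {a. lt a \<beta>}. \<C> a)"
    obtain T where T: "openin (Homeo_cpt_top X) T" "U \<inter> Homeo_K X (K \<beta>) = T \<inter> Homeo_K X (K \<beta>)"
      using UK[OF compact[OF \<beta>]] by (auto simp: openin_subtopology)
    have "id \<in> Homeo_K X (K \<beta>)"
      by (simp add: Homeo_K_def Homeo_def)
    then have "id \<in> T"
      using T(2) U(2) by blast
    have sepD: "\<exists>(A, B) \<in> \<D>. interior_separated X x y A B" if "x \<in> K \<beta>" "y \<in> K \<beta>" "x \<noteq> y" for x y
      using intsep[OF _ that] s(2) unfolding \<D>_def by blast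
    obtain P where P: "finite P" "P \<subseteq> \<D>" "\<forall>h \<in> Homeo_K X (K \<beta>). near_id X P h \<longrightarrow> h \<in> T"
      using near_id_neighbourhood_base[OF X compact[OF \<beta>] sepD T(1) \<open>id \<in> T\<close>] by blast
    have "P \<in> Q"
      using P in_Field by (fastforce simp: Q_def \<D>_def)
    have s_mono: "(s m, s n) \<in> \<kappa>" if "m \<le> n" for m n
      using that by (induction n rule: dec_induct) (use sF le_refl le_trans G(1) s(1) in \<open>metis\<close>)+
    \<comment> \<open>Finiteness of \<open>P\<close> enters here: its finitely many indices below
      \<beta> all lie below one member of the increasing sequence \<open>s\<close>.\<close>
    have "\<exists>n. P \<subseteq> \<C>u (s n)"
      using P(1,2)
    proof (induction P rule: finite_induct)
      case (insert p P)
      then obtain m a where m: "P \<subseteq> \<C>u (s m)" "p \<in> \<C> a" "lt a \<beta>"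
        by (auto simp: \<D>_def)
      then obtain n where n: "(a, s n) \<in> \<kappa>"
        using s(3) by blast
      have "\<C>u (s m) \<subseteq> \<C>u (s (max m n))"
        by (rule \<C>u_mono[OF s_mono]) simp
      moreover have "(a, s (max m n)) \<in> \<kappa>"
        by (rule le_trans[OF n s_mono]) simp
      then have "p \<in> \<C>u (s (max m n))"
        using m(2) unfolding \<C>u_def under_def by blast
      ultimately show ?case
        using m(1) by blast
    qed simp
    then obtain n where "P \<subseteq> \<C>u (s n)" ..
    \<comment> \<open>One further step of the iteration absorbs the support: \<open>b P\<close> is
      at most \<open>G (s n)\<close>, which is \<open>s (Suc n)\<close> and lies below
      \<beta>.\<close>
    then have "(b P, \<beta>) \<in> \<kappa>"
      using G(2)[OF sF P(1)] s(1,2) le_trans by metis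
    then have "h P \<in> Homeo_K X (K \<beta>)"
      using h(1)[OF \<open>P \<in> Q\<close>] mono Homeo_K_mono by blast
    then have "h P \<in> U"
      using P(3) h(3)[OF \<open>P \<in> Q\<close>] T(2) by blast
    then show False
      using h(4)[OF \<open>P \<in> Q\<close>] by blast
  qed
qed

end

section \<open>Order topologies\<close>

lemma functionally_separated_pullback:
  assumes p: "continuous_map X Y p" and "functionally_separated Y A B"
  shows "functionally_separated X {x \<in> topspace X. p x \<in> A} {x \<in> topspace X. p x \<in> B}"
proof -
  obtain f where f: "f \<in> cb_funs Y" "\<And>y. y \<in> topspace Y \<Longrightarrow> (y \<in> A \<longrightarrow> f y = 0) \<and> (y \<in> B \<longrightarrow> f y = 1)"
    using assms(2) unfolding functionally_separated_def by blast
  have "f \<circ> p \<in> cb_funs X"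
    using f(1) p continuous_map_compose unfolding cb_funs_def by blast
  moreover have "p x \<in> topspace Y" if "x \<in> topspace X" for x
    using that continuous_map_image_subset_topspace[OF p] by blast
  ultimately show ?thesis
    unfolding functionally_separated_def using f(2) by (intro bexI[of _ "f \<circ> p"]) auto
qed

lemma interior_of_pullback:
  assumes p: "continuous_map X Y p" and "x \<in> topspace X" "p x \<in> Y interior_of A"
  shows "x \<in> X interior_of {x \<in> topspace X. p x \<in> A}"
proof -
  have "openin X {x \<in> topspace X. p x \<in> Y interior_of A}"
    by (rule openin_continuous_map_preimage[OF p]) simp
  moreover have "{x \<in> topspace X. p x \<in> Y interior_of A} \<subseteq> {x \<in> topspace X. p x \<in> A}"
    using interior_of_subset[of Y A] by blast
  ultimately have "{x \<in> topspace X. p x \<in> Y interior_of A} \<subseteq> X interior_of {x \<in> topspace X. p x \<in> A}"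
    by (simp only: interior_of_maximal)
  then show ?thesis
    using assms by blast
qed

lemma interior_separated_pullback:
  assumes p: "continuous_map X Y p" and "x \<in> topspace X" "y \<in> topspace X"
    and "interior_separated Y (p x) (p y) A B"
  shows "interior_separated X x y {x \<in> topspace X. p x \<in> A} {x \<in> topspace X. p x \<in> B}"
  using assms(4) interior_of_pullback[OF p assms(2)] interior_of_pullback[OF p assms(3)]
  unfolding interior_separated_def by blast

lemma interior_separated_sym: "interior_separated X x y A B \<Longrightarrow> interior_separated X y x A B"
  unfolding interior_separated_def by blast

text \<open>The test pairs of the long line and of products come from the ray and from the factors
  through this map, so their number is bounded by that of the original pairs.\<close>

definition pullback_pair :: "'a topology \<Rightarrow> ('a \<Rightarrow> 'b) \<Rightarrow> 'b set \<times> 'b set \<Rightarrow> 'a set \<times> 'a set" where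
  "pullback_pair X p P = ({x \<in> topspace X. p x \<in> fst P}, {x \<in> topspace X. p x \<in> snd P})"

section \<open>Order topologies on a carrier: rays, Hausdorff separation, compact segments\<close>

locale strict_linorder_on =
  fixes S :: "'a set" and less :: "'a \<Rightarrow> 'a \<Rightarrow> bool"
  assumes irrefl: "\<And>x. x \<in> S \<Longrightarrow> \<not> less x x"
    and trans: "\<And>x y z. x \<in> S \<Longrightarrow> y \<in> S \<Longrightarrow> z \<in> S \<Longrightarrow> less x y \<Longrightarrow> less y z \<Longrightarrow> less x z"
    and total: "\<And>x y. x \<in> S \<Longrightarrow> y \<in> S \<Longrightarrow> x \<noteq> y \<Longrightarrow> less x y \<or> less y x"
begin

lemma asym: "x \<in> S \<Longrightarrow> y \<in> S \<Longrightarrow> less x y \<Longrightarrow> \<not> less y x"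
  using trans[of x y x] irrefl[of x] by blast

lemma topspace_order_top: "topspace (order_top S less) = S"
  unfolding order_top_def topology_generated_by_topspace by blast

lemma openin_less: "a \<in> S \<Longrightarrow> openin (order_top S less) {y \<in> S. less y a}"
  unfolding order_top_def by (rule topology_generated_by_Basis) blast

lemma openin_greater: "a \<in> S \<Longrightarrow> openin (order_top S less) {y \<in> S. less a y}"
  unfolding order_top_def by (rule topology_generated_by_Basis) blast

lemma closedin_ge:
  assumes "a \<in> S"
  shows "closedin (order_top S less) {y \<in> S. \<not> less y a}"
proof -
  have "topspace (order_top S less) - {y \<in> S. \<not> less y a} = {y \<in> S. less y a}"
    unfolding topspace_order_top by blast
  then show ?thesis
    unfolding closedin_def using openin_less[OF assms] topspace_order_top by auto
qed

lemma continuous_map_into_order_top: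
  assumes "p ` topspace X \<subseteq> S"
    and "\<And>a. a \<in> S \<Longrightarrow> openin X {x \<in> topspace X. less (p x) a}"
    and "\<And>a. a \<in> S \<Longrightarrow> openin X {x \<in> topspace X. less a (p x)}"
  shows "continuous_map X (order_top S less) p"
  unfolding order_top_def
proof (rule continuous_on_generated_topo)
  fix U assume "U \<in> {S} \<union> {{y \<in> S. less y a} |a. a \<in> S} \<union> {{y \<in> S. less a y} |a. a \<in> S}"
  then consider "U = S" | a where "a \<in> S" "U = {y \<in> S. less y a}" | a where "a \<in> S" "U = {y \<in> S. less a y}"
    by blast
  then show "openin X (p -` U \<inter> topspace X)"
  proof cases
    case 1
    then have "p -` U \<inter> topspace X = topspace X"
      using assms(1) by blast
    then show ?thesis by simp
  next
    case (2 a)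
    then have "p -` U \<inter> topspace X = {x \<in> topspace X. less (p x) a}"
      using assms(1) by blast
    then show ?thesis using assms(2) 2 by simp
  next
    case (3 a)
    then have "p -` U \<inter> topspace X = {x \<in> topspace X. less a (p x)}"
      using assms(1) by blast
    then show ?thesis using assms(3) 3 by simp
  qed
qed (use assms(1) in blast)

lemma Hausdorff_space_order_top: "Hausdorff_space (order_top S less)"
proof -
  have sep: "\<exists>U V. openin (order_top S less) U \<and> openin (order_top S less) V \<and> x \<in> U \<and> y \<in> V \<and> disjnt U V"
    if xy: "x \<in> S" "y \<in> S" "less x y" for x y
  proof (cases "\<exists>z \<in> S. less x z \<and> less z y")
    case True
    then obtain z where z: "z \<in> S" "less x z" "less z y" by blast
    have "disjnt {w \<in> S. less w z} {w \<in> S. less z w}"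
      unfolding disjnt_iff using trans irrefl z(1) by blast
    then show ?thesis
      using z xy openin_less[OF z(1)] openin_greater[OF z(1)] by blast
  next
    \<comment> \<open>At a jump nothing lies strictly between \<open>x\<close> and \<open>y\<close>,
      so the ray below \<open>y\<close> and the ray above \<open>x\<close> are disjoint.\<close>
    case False
    then have "disjnt {w \<in> S. less w y} {w \<in> S. less x w}"
      unfolding disjnt_iff by blast
    then show ?thesis
      using xy openin_less[OF xy(2)] openin_greater[OF xy(1)] by blast
  qed
  show ?thesis
    unfolding Hausdorff_space_def topspace_order_top
  proof clarify
    fix x y assume "x \<in> S" "y \<in> S" "x \<noteq> y"
    then consider "less x y" | "less y x"
      using total by blast
    then show "\<exists>U V. openin (order_top S less) U \<and> openin (order_top S less) V \<and> x \<in> U \<and> y \<in> V \<and> disjnt U V"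
    proof cases
      case 2
      with sep[of y x] \<open>x \<in> S\<close> \<open>y \<in> S\<close> show ?thesis
        by (metis disjnt_sym)
    qed (use sep \<open>x \<in> S\<close> \<open>y \<in> S\<close> in blast)
  qed
qed

text \<open>By the Alexander subbase theorem only covers by open rays matter, and of such a cover
  two rays meeting at the supremum of the left rays suffice.\<close>
lemma compactin_initial_segment:
  assumes b: "b \<in> S"
    and complete: "\<And>L. L \<subseteq> {x \<in> S. \<not> less b x} \<Longrightarrow>
      \<exists>s \<in> S. \<not> less b s \<and> (\<forall>a \<in> L. \<not> less s a) \<and> (\<forall>t \<in> S. less t s \<longrightarrow> (\<exists>a \<in> L. less t a))"
  shows "compactin (order_top S less) {x \<in> S. \<not> less b x}"
proof -
  define K where "K = {x \<in> S. \<not> less b x}"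
  define \<B> where "\<B> = {S} \<union> {{y \<in> S. less y a} | a. a \<in> S} \<union> {{y \<in> S. less a y} | a. a \<in> S}"
  \<comment> \<open>The segment is presented through the traces of the rays, the form to which the
    subbase theorem applies; its compactness is then transported along the inclusion.\<close>
  define Y where "Y = topology (arbitrary union_of (finite intersection_of (\<lambda>x. x \<in> \<B>) relative_to K))"
  have topY: "topspace Y = K"
    unfolding Y_def by (rule topspace_subbase)
  have "compact_space Y"
  proof (rule Alexander_subbase_alt)
    show "K \<subseteq> \<Union>\<B>"
      unfolding \<B>_def K_def by blast
    show "topology (arbitrary union_of (finite intersection_of (\<lambda>x. x \<in> \<B>) relative_to K)) = Y"
      by (simp add: Y_def)
    fix C assume C: "C \<subseteq> \<B>" and KC: "K \<subseteq> \<Union>C"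
    \<comment> \<open>These are the endpoints of left rays in the cover that do not pass
      \<open>b\<close>; a left ray with endpoint beyond \<open>b\<close> covers the segment alone.
      If there are none, \<open>complete\<close> makes \<open>s\<close> the least point, which lies
      in no right ray.\<close>
    define L where "L = {a \<in> S. {y \<in> S. less y a} \<in> C \<and> \<not> less b a}"
    have "L \<subseteq> {x \<in> S. \<not> less b x}"
      unfolding L_def by blast
    then obtain s where s: "s \<in> S" "\<not> less b s" "\<And>a. a \<in> L \<Longrightarrow> \<not> less s a"
        "\<And>t. t \<in> S \<Longrightarrow> less t s \<Longrightarrow> \<exists>a \<in> L. less t a"
      using complete[of L] by blast
    then obtain c where c: "c \<in> C" "s \<in> c"
      using KC unfolding K_def by blast
    then consider "c = S" | a where "a \<in> S" "c = {y \<in> S. less y a}" | a where "a \<in> S" "c = {y \<in> S. less a y}"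
      using C unfolding \<B>_def by blast
    then show "\<exists>C'. finite C' \<and> C' \<subseteq> C \<and> K \<subseteq> \<Union>C'"
    proof cases
      case 1
      then show ?thesis
        using c(1) by (intro exI[of _ "{c}"]) (auto simp: K_def)
    next
      case (2 a)
      then have "a \<notin> L"
        using s(3) c(2) by blast
      then have "less b a"
        using 2 c(1) unfolding L_def by blast
      then have "K \<subseteq> c"
        unfolding K_def 2 using trans total 2(1) b by blast
      then show ?thesis
        using c(1) by (intro exI[of _ "{c}"]) auto
    next
      case (3 t)
      then obtain a where a: "a \<in> L" "less t a"
        using s(4) c(2) by blast
      then have "K \<subseteq> c \<union> {y \<in> S. less y a}"
        unfolding K_def 3 L_def using trans total 3(1) by blast
      then show ?thesis
        using c(1) a(1) by (intro exI[of _ "{c, {y \<in> S. less y a}}"]) (auto simp: L_def)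
    qed
  qed
  moreover have "continuous_map Y (order_top S less) id"
    unfolding order_top_def \<B>_def[symmetric]
  proof (rule continuous_on_generated_topo)
    fix U assume "U \<in> \<B>"
    then have "(arbitrary union_of (finite intersection_of (\<lambda>x. x \<in> \<B>) relative_to K)) (K \<inter> U)"
      by (intro arbitrary_union_of_inc relative_to_inc finite_intersection_of_inc)
    then show "openin Y (id -` U \<inter> topspace Y)"
      unfolding topY unfolding Y_def openin_subbase by (simp add: Int_commute)
  qed (auto simp: topY K_def \<B>_def)
  ultimately have "compactin (order_top S less) (id ` topspace Y)"
    using image_compactin unfolding compact_space_def by blast
  then show ?thesis
    by (simp add: topY K_def)
qed

text \<open>The left rays with endpoints in \<open>D\<close> cover the space and are nested, so a
  finite subcover amounts to one ray. This yields the cofinality of the chosen compact sets, for the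
  ray and for the ordinal factors.\<close>

lemma compactin_bounded:
  assumes L: "compactin (order_top S less) L" and D: "D \<subseteq> S" "D \<noteq> {}"
    and cover: "\<And>x. x \<in> S \<Longrightarrow> \<exists>d \<in> D. less x d"
  shows "\<exists>d \<in> D. \<forall>x \<in> L. less x d"
proof -
  have LS: "L \<subseteq> S"
    using compactin_subset_topspace[OF L] by (simp add: topspace_order_top)
  have "\<exists>\<F>. finite \<F> \<and> \<F> \<subseteq> (\<lambda>d. {y \<in> S. less y d}) ` D \<and> L \<subseteq> \<Union>\<F>"
  proof (rule compactinD[OF L])
    show "openin (order_top S less) U" if "U \<in> (\<lambda>d. {y \<in> S. less y d}) ` D" for U
      using that openin_less D(1) by blast
    show "L \<subseteq> \<Union>((\<lambda>d. {y \<in> S. less y d}) ` D)"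
      using cover LS by blast
  qed
  then obtain F where F: "finite F" "F \<subseteq> D" "L \<subseteq> (\<Union>d\<in>F. {y \<in> S. less y d})"
    by (metis (no_types, lifting) finite_subset_image)
  \<comment> \<open>The largest endpoint in \<open>F\<close>; if \<open>F\<close> is empty, any
    element of \<open>D\<close> serves.\<close>
  have "\<exists>d \<in> D. \<forall>x \<in> S. (\<exists>e \<in> F. less x e) \<longrightarrow> less x d"
    using F(1,2)
  proof (induction F rule: finite_induct)
    case empty
    then show ?case using D(2) by blast
  next
    case (insert e F)
    then obtain d where d: "d \<in> D" "\<forall>x \<in> S. (\<exists>e \<in> F. less x e) \<longrightarrow> less x d"
      by blast
    have "e \<in> D" using insert by blast
    consider "e = d" | "less e d" | "less d e"
      using total \<open>e \<in> D\<close> d(1) D(1) by blast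
    then show ?case
    proof cases
      case 3
      then have "\<forall>x \<in> S. (\<exists>e \<in> insert e F. less x e) \<longrightarrow> less x e"
        using d trans D(1) \<open>e \<in> D\<close> by blast
      then show ?thesis using \<open>e \<in> D\<close> by blast
    next
      case 2
      then have "\<forall>x \<in> S. (\<exists>e \<in> insert e F. less x e) \<longrightarrow> less x d"
        using d trans D(1) \<open>e \<in> D\<close> by blast
      then show ?thesis using d(1) by blast
    qed (use d in blast)
  qed
  then show ?thesis
    using F(3) LS by blast
qed

end

section \<open>The long ray\<close>

text \<open>The successor of an infinite cardinal is regular, and a countable field would bound
  \<open>omega1\<close> by \<open>natLeq\<close>, whose cardinal successor it is.\<close>

lemma regular_uncountable_omega1: "regular_uncountable omega1"
proof
  show card: "Card_order omega1"
    by (rule cardSuc_Card_order[OF natLeq_Card_order])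
  show "regularCard omega1"
    by (rule infinite_cardSuc_regularCard[OF _ natLeq_Card_order]) (simp add: Field_natLeq)
  show "\<not> countable (Field omega1)"
  proof
    assume "countable (Field omega1)"
    then obtain f :: "nat set \<Rightarrow> nat" where "inj_on f (Field omega1)"
      by (rule countableE)
    then have "|Field omega1| \<le>o |UNIV :: nat set|"
      using card_of_ordLeq[of "Field omega1" "UNIV :: nat set"] by blast
    then have "|Field omega1| \<le>o natLeq"
      using ordLeq_ordIso_trans card_of_nat by blast
    then have "omega1 \<le>o natLeq"
      using card_of_Field_ordIso[OF card] ordIso_ordLeq_trans ordIso_symmetric by blast
    then show False
      using cardSuc_greater[OF natLeq_Card_order] not_ordLess_ordLeq by blast
  qed
qed

interpretation omega1: regular_uncountable omega1
  by (rule regular_uncountable_omega1)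

lemma long_ray_less_trans:
  assumes xy: "long_ray_less x y" and yz: "long_ray_less y z"
  shows "long_ray_less x z"
proof (cases "fst x = fst y \<or> fst y = fst z")
  case True
  then show ?thesis
    using xy yz unfolding long_ray_less_def by force
next
  case False
  then have "(fst x, fst y) \<in> omega1" "fst x \<noteq> fst y" "(fst y, fst z) \<in> omega1"
    using xy yz by (simp_all add: long_ray_less_def)
  then have "(fst x, fst z) \<in> omega1 \<and> fst x \<noteq> fst z"
    by (rule omega1.less_le_trans[OF conjI])
  then show ?thesis
    unfolding long_ray_less_def by blast
qed

lemma long_ray_less_total:
  assumes "x \<in> long_ray_set" "y \<in> long_ray_set" "x \<noteq> y"
  shows "long_ray_less x y \<or> long_ray_less y x"
proof (cases "fst x = fst y")
  case True
  then have "snd x \<noteq> snd y"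
    using assms(3) prod_eqI by blast
  then have "snd x < snd y \<or> snd y < snd x"
    by linarith
  then show ?thesis
    using True by (simp add: long_ray_less_def)
next
  case False
  have "fst x \<in> Field omega1" "fst y \<in> Field omega1"
    using assms by (auto simp: long_ray_set_def)
  then show ?thesis
    using False omega1.le_total unfolding long_ray_less_def by metis
qed

interpretation ray: strict_linorder_on long_ray_set long_ray_less
proof
  show "\<not> long_ray_less x x" for x
    by (simp add: long_ray_less_def)
qed (use long_ray_less_trans long_ray_less_total in blast)+

text \<open>The supremum is read off the upper bounds lexicographically: the least ordinal \<alpha>
  occurring in them, by well-ordering, then the infimum of the reals over \<alpha>. That fibre is
  nonempty and inside \<open>{0..<1}\<close>, so the infimum is again an admissible coordinate. For
  empty \<open>L\<close> this gives the least point.\<close>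

lemma long_ray_complete:
  assumes b: "b \<in> long_ray_set" and L: "L \<subseteq> {x \<in> long_ray_set. \<not> long_ray_less b x}"
  shows "\<exists>s \<in> long_ray_set. \<not> long_ray_less b s \<and> (\<forall>a \<in> L. \<not> long_ray_less s a) \<and>
     (\<forall>t \<in> long_ray_set. long_ray_less t s \<longrightarrow> (\<exists>a \<in> L. long_ray_less t a))"
proof -
  define U where "U = {u \<in> long_ray_set. \<forall>a \<in> L. \<not> long_ray_less u a}"
  have "b \<in> U"
    using b L unfolding U_def by blast
  then have "fst ` U \<noteq> {}"
    by blast
  moreover have "fst ` U \<subseteq> Field omega1"
    by (auto simp: U_def long_ray_set_def)
  ultimately obtain \<alpha> where \<alpha>: "\<alpha> \<in> fst ` U" "\<And>\<gamma>. \<gamma> \<in> fst ` U \<Longrightarrow> (\<alpha>, \<gamma>) \<in> omega1"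
    using omega1.least_exists by metis
  define V where "V = {t. (\<alpha>, t) \<in> U}"
  obtain t0 where t0: "t0 \<in> V"
    using \<alpha>(1) by (auto simp: V_def)
  have V01: "0 \<le> t \<and> t < 1" if "t \<in> V" for t
    using that by (auto simp: V_def U_def long_ray_set_def)
  then have bdd: "bdd_below V"
    by (meson bdd_belowI)
  define s where "s = (\<alpha>, Inf V)"
  have "0 \<le> Inf V"
    using V01 t0 by (intro cInf_greatest) auto
  moreover have "Inf V < 1"
    using cInf_lower[OF t0 bdd] V01[OF t0] by linarith
  moreover have "\<alpha> \<in> Field omega1"
    using \<alpha>(1) by (auto simp: U_def long_ray_set_def)
  ultimately have sS: "s \<in> long_ray_set"
    by (simp add: s_def long_ray_set_def)
  have lower: "\<not> long_ray_less u s" if "u \<in> U" for u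
  proof
    assume less: "long_ray_less u s"
    have "(\<alpha>, fst u) \<in> omega1"
      using \<alpha>(2) that by blast
    then have u: "fst u = \<alpha>" "snd u < Inf V"
      using less omega1.le_antisym unfolding long_ray_less_def s_def by auto
    then have "snd u \<in> V"
      using that by (cases u) (simp add: V_def)
    then show False
      using cInf_lower[OF _ bdd] u(2) by fastforce
  qed
  have "\<not> long_ray_less s a" if "a \<in> L" for a
  proof
    assume less: "long_ray_less s a"
    have t0a: "\<not> long_ray_less (\<alpha>, v) a" if "v \<in> V" for v
      using that \<open>a \<in> L\<close> by (auto simp: V_def U_def)
    then have "fst a = \<alpha>" "Inf V < snd a"
      using less t0a[OF t0] unfolding long_ray_less_def s_def by auto
    then obtain v where "v \<in> V" "v < snd a"
      using cInf_lessD[of V "snd a"] t0 by blast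
    then show False
      using t0a[of v] \<open>fst a = \<alpha>\<close> by (simp add: long_ray_less_def)
  qed
  moreover have "\<exists>a \<in> L. long_ray_less t a" if "t \<in> long_ray_set" "long_ray_less t s" for t
    using that lower[of t] unfolding U_def by blast
  ultimately show ?thesis
    using sS lower[OF \<open>b \<in> U\<close>] by blast
qed

lemma compactin_long_ray_le:
  "b \<in> long_ray_set \<Longrightarrow> compactin long_ray {x \<in> long_ray_set. \<not> long_ray_less b x}"
  unfolding long_ray_def by (rule ray.compactin_initial_segment) (use long_ray_complete in blast)+

lemma topspace_long_ray: "topspace long_ray = long_ray_set"
  unfolding long_ray_def by (rule ray.topspace_order_top)

lemma Hausdorff_space_long_ray: "Hausdorff_space long_ray"
  unfolding long_ray_def by (rule ray.Hausdorff_space_order_top)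

text \<open>The segment ends at the first point of the block of \<alpha>, not at the end of that
  block. Hence the smaller of two distinct points of it lies in a block of index strictly below
  \<alpha>, as the criterion demands.\<close>

definition long_ray_segment :: "nat set \<Rightarrow> (nat set \<times> real) set" where
  "long_ray_segment \<alpha> = {x \<in> long_ray_set. \<not> long_ray_less (\<alpha>, 0) x}"

text \<open>Rational positions keep the family countable, and the gap between \<open>q\<close> and
  \<open>r\<close> leaves room for a continuous function rising from 0 to 1 inside the
  block.\<close>

definition long_ray_cuts :: "nat set \<Rightarrow> ((nat set \<times> real) set \<times> (nat set \<times> real) set) set" where
  "long_ray_cuts \<alpha> = (\<lambda>(q, r). ({x \<in> long_ray_set. \<not> long_ray_less (\<alpha>, of_rat q) x},
                                {x \<in> long_ray_set. \<not> long_ray_less x (\<alpha>, of_rat r)})) `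
     {(q, r). 0 \<le> q \<and> q < r \<and> r < 1}"

lemma countable_long_ray_cuts: "countable (long_ray_cuts \<alpha>)"
  unfolding long_ray_cuts_def by (rule countable_image) (rule countableI_type)

lemma long_ray_point: "\<alpha> \<in> Field omega1 \<Longrightarrow> 0 \<le> t \<Longrightarrow> t < 1 \<Longrightarrow> (\<alpha>, t) \<in> long_ray_set"
  by (simp add: long_ray_set_def)

lemma compactin_long_ray_segment: "\<alpha> \<in> Field omega1 \<Longrightarrow> compactin long_ray (long_ray_segment \<alpha>)"
  unfolding long_ray_segment_def by (intro compactin_long_ray_le long_ray_point) auto

lemma long_ray_segment_mono:
  assumes "(\<alpha>, \<beta>) \<in> omega1"
  shows "long_ray_segment \<alpha> \<subseteq> long_ray_segment \<beta>"
proof (cases "\<alpha> = \<beta>")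
  case False
  have F: "(\<alpha>, 0) \<in> long_ray_set" "(\<beta>, 0) \<in> long_ray_set"
    using omega1.in_Field[OF assms] by (simp_all add: long_ray_point)
  have "long_ray_less (\<alpha>, 0) (\<beta>, 0)"
    using assms False by (simp add: long_ray_less_def)
  then show ?thesis
    unfolding long_ray_segment_def using ray.trans[OF F] by blast
qed simp

lemma compactin_long_ray_bounded:
  assumes "compactin long_ray L"
  shows "\<exists>\<alpha> \<in> Field omega1. L \<subseteq> long_ray_segment \<alpha> \<and> (\<forall>x \<in> L. long_ray_less x (\<alpha>, 0))"
proof -
  let ?D = "(\<lambda>\<alpha>. (\<alpha>, 0 :: real)) ` Field omega1"
  have "?D \<subseteq> long_ray_set"
    by (auto simp: long_ray_point)
  moreover have "?D \<noteq> {}"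
    using omega1.infinite_Field by fastforce
  moreover have "\<exists>d \<in> ?D. long_ray_less x d" if "x \<in> long_ray_set" for x
  proof -
    have "fst x \<in> Field omega1"
      using that by (auto simp: long_ray_set_def)
    then obtain b where b: "(fst x, b) \<in> omega1" "fst x \<noteq> b"
      using omega1.exists_greater by blast
    then have "long_ray_less x (b, 0)"
      by (simp add: long_ray_less_def)
    then show ?thesis
      using omega1.in_Field[OF b(1)] by blast
  qed
  ultimately have "\<exists>d \<in> ?D. \<forall>x \<in> L. long_ray_less x d"
    by (rule ray.compactin_bounded[OF assms[unfolded long_ray_def]])
  then obtain \<alpha> where \<alpha>: "\<alpha> \<in> Field omega1" "\<forall>x \<in> L. long_ray_less x (\<alpha>, 0)"
    by blast
  have S: "(\<alpha>, 0) \<in> long_ray_set"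
    using \<alpha>(1) by (simp add: long_ray_point)
  have "L \<subseteq> long_ray_set"
    using compactin_subset_topspace[OF assms] by (simp add: topspace_long_ray)
  then have "L \<subseteq> long_ray_segment \<alpha>"
    unfolding long_ray_segment_def using \<alpha>(2) ray.asym[OF _ S] by blast
  then show ?thesis
    using \<alpha> by blast
qed

text \<open>An open left ray is a neighbourhood inside a compact segment, so the space is locally
  compact and Hausdorff. This is the source of the separating functions.\<close>

lemma completely_regular_space_long_ray: "completely_regular_space long_ray"
proof (rule locally_compact_regular_imp_completely_regular_space)
  show "locally_compact_space long_ray"
    unfolding locally_compact_space_def
  proof
    fix x assume "x \<in> topspace long_ray"
    then have "compactin long_ray {x}"
      by simp
    from compactin_long_ray_bounded[OF this]
    obtain \<alpha> where \<alpha>: "\<alpha> \<in> Field omega1" "long_ray_less x (\<alpha>, 0)"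
      by blast
    have S: "(\<alpha>, 0) \<in> long_ray_set"
      using \<alpha>(1) by (simp add: long_ray_point)
    have "openin long_ray {y \<in> long_ray_set. long_ray_less y (\<alpha>, 0)}"
      unfolding long_ray_def by (rule ray.openin_less[OF S])
    moreover have "{y \<in> long_ray_set. long_ray_less y (\<alpha>, 0)} \<subseteq> long_ray_segment \<alpha>"
      unfolding long_ray_segment_def using ray.asym[OF _ S] by blast
    moreover have "x \<in> {y \<in> long_ray_set. long_ray_less y (\<alpha>, 0)}"
      using \<open>x \<in> topspace long_ray\<close> \<alpha>(2) by (simp add: topspace_long_ray)
    ultimately show "\<exists>U K. openin long_ray U \<and> compactin long_ray K \<and> x \<in> U \<and> U \<subseteq> K"
      using compactin_long_ray_segment[OF \<alpha>(1)] by blast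
  qed
qed (simp add: Hausdorff_space_long_ray)

text \<open>The lower part is compact and the upper part closed and disjoint from it, which complete
  regularity separates.\<close>

lemma functionally_separated_long_ray_cuts:
  assumes \<alpha>: "\<alpha> \<in> Field omega1" and "(A, B) \<in> long_ray_cuts \<alpha>"
  shows "functionally_separated long_ray A B"
proof -
  obtain p where p: "p \<in> {(q, r). 0 \<le> q \<and> q < r \<and> r < (1 :: rat)}"
      and AB: "(A, B) = (case p of (q, r) \<Rightarrow> ({x \<in> long_ray_set. \<not> long_ray_less (\<alpha>, of_rat q) x},
                                {x \<in> long_ray_set. \<not> long_ray_less x (\<alpha>, of_rat r)}))"
    using assms(2) unfolding long_ray_cuts_def by (rule imageE) simp
  obtain q r where pqr: "p = (q, r)"
    by fastforce
  have qr: "0 \<le> q" "q < r" "r < 1"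
    using p by (simp_all add: pqr)
  have A: "A = {x \<in> long_ray_set. \<not> long_ray_less (\<alpha>, of_rat q) x}"
    and B: "B = {x \<in> long_ray_set. \<not> long_ray_less x (\<alpha>, of_rat r)}"
    using AB by (simp_all add: pqr)
  have q: "(\<alpha>, of_rat q) \<in> long_ray_set" and r: "(\<alpha>, of_rat r) \<in> long_ray_set"
    using \<alpha> qr by (auto intro!: long_ray_point)
  have "compactin long_ray A"
    unfolding A by (rule compactin_long_ray_le[OF q])
  moreover have "closedin long_ray B"
    unfolding B long_ray_def by (rule ray.closedin_ge[OF r])
  moreover have "disjnt B A"
  proof -
    have "long_ray_less (\<alpha>, of_rat q) (\<alpha>, of_rat r)"
      using qr by (simp add: long_ray_less_def of_rat_less)
    then have "long_ray_less (\<alpha>, of_rat q) z" if "z \<in> B" for z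
      using that ray.total[OF _ r, of z] long_ray_less_trans[of _ "(\<alpha>, of_rat r)" z] unfolding B by blast
    then show ?thesis
      unfolding disjnt_iff A by blast
  qed
  ultimately have "\<exists>f. continuous_map long_ray (top_of_set {0..1::real}) f \<and> f ` A \<subseteq> {0} \<and> f ` B \<subseteq> {1}"
    using Urysohn_completely_regular_closed_compact[OF zero_le_one completely_regular_space_long_ray, of B A]
    by metis
  then obtain f where f: "continuous_map long_ray (top_of_set {0..1::real}) f" "f ` A \<subseteq> {0}" "f ` B \<subseteq> {1}"
    by blast
  show ?thesis
    unfolding functionally_separated_def cb_funs_def
    using f by (intro bexI[of _ f]) auto
qed

text \<open>The cut is made in the block of the smaller point, whatever block the larger one lies
  in.\<close>

lemma interior_separated_long_ray:
  assumes x: "x \<in> long_ray_segment \<beta>" and y: "y \<in> long_ray_segment \<beta>" and "x \<noteq> y"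
    and \<beta>: "\<beta> \<in> Field omega1"
  shows "\<exists>\<alpha>. (\<alpha>, \<beta>) \<in> omega1 \<and> \<alpha> \<noteq> \<beta> \<and> (\<exists>(A, B) \<in> long_ray_cuts \<alpha>. interior_separated long_ray x y A B)"
proof -
  have main: "\<exists>\<alpha>. (\<alpha>, \<beta>) \<in> omega1 \<and> \<alpha> \<noteq> \<beta> \<and> (\<exists>(A, B) \<in> long_ray_cuts \<alpha>. interior_separated long_ray x y A B)"
    if x: "x \<in> long_ray_segment \<beta>" and y: "y \<in> long_ray_segment \<beta>" and less: "long_ray_less x y" for x y
  proof -
    have xS: "x \<in> long_ray_set" and yS: "y \<in> long_ray_set"
      using x y by (auto simp: long_ray_segment_def)
    define \<alpha> where "\<alpha> = fst x"
    have \<alpha>: "\<alpha> \<in> Field omega1" and x1: "0 \<le> snd x" "snd x < 1"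
      and y1: "fst y \<in> Field omega1" "0 \<le> snd y" "snd y < 1"
      using xS yS by (auto simp: \<alpha>_def long_ray_set_def)
    have y\<beta>: "\<not> long_ray_less (\<beta>, 0) y"
      using y by (simp add: long_ray_segment_def)
    have y\<beta>': "(fst y, \<beta>) \<in> omega1"
      using omega1.le_total[OF y1(1) \<beta>] y\<beta> by (auto simp: long_ray_less_def)
    \<comment> \<open>If both points share a block, the real coordinate of \<open>y\<close> is
      positive, so that block cannot be the one of \<beta>, of which only the first point is
      present. Otherwise the block of \<open>x\<close> precedes that of \<open>y\<close>.\<close>
    have lt: "(\<alpha>, \<beta>) \<in> omega1 \<and> \<alpha> \<noteq> \<beta>"
    proof (cases "fst x = fst y")
      case True
      then have "snd x < snd y"
        using less by (simp add: long_ray_less_def)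
      then have "fst y \<noteq> \<beta>"
        using y\<beta> x1 by (auto simp: long_ray_less_def)
      then show ?thesis
        using y\<beta>' True by (simp add: \<alpha>_def)
    next
      case False
      then have "(fst x, fst y) \<in> omega1 \<and> fst x \<noteq> fst y"
        using less by (simp add: long_ray_less_def)
      then show ?thesis
        using y\<beta>' omega1.less_le_trans unfolding \<alpha>_def by blast
    qed
    \<comment> \<open>\<open>m\<close> bounds the room above \<open>x\<close> in its block: up to
      \<open>y\<close> if \<open>y\<close> is in the same block, up to the end of the block
      otherwise. Two rationals are placed in this interval.\<close>
    define m where "m = (if fst y = \<alpha> then snd y else 1)"
    have "snd x < m"
      using less x1 by (auto simp: m_def long_ray_less_def \<alpha>_def)
    then obtain q where q: "snd x < of_rat q" "of_rat q < m"
      using of_rat_dense by blast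
    then obtain r where r: "of_rat q < real_of_rat r" "of_rat r < m"
      using of_rat_dense by blast
    have "m \<le> 1"
      using y1 by (simp add: m_def)
    have qr: "0 \<le> q" "q < r" "r < 1"
    proof -
      have "0 \<le> real_of_rat q" "real_of_rat r < 1"
        using q r x1 \<open>m \<le> 1\<close> by linarith+
      then show "0 \<le> q" "r < 1" "q < r"
        using r(1) by (simp_all add: of_rat_less)
    qed
    have qS: "(\<alpha>, of_rat q) \<in> long_ray_set" and rS: "(\<alpha>, of_rat r) \<in> long_ray_set"
      using \<alpha> qr by (auto intro!: long_ray_point)
    define A where "A = {x \<in> long_ray_set. \<not> long_ray_less (\<alpha>, of_rat q) x}"
    define B where "B = {x \<in> long_ray_set. \<not> long_ray_less x (\<alpha>, of_rat r)}"
    have AB: "(A, B) \<in> long_ray_cuts \<alpha>"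
      unfolding long_ray_cuts_def A_def B_def using qr by (intro image_eqI[of _ _ "(q, r)"]) auto
    have "{x \<in> long_ray_set. long_ray_less x (\<alpha>, of_rat q)} \<subseteq> A"
      unfolding A_def using ray.asym[OF _ qS] by blast
    then have "{x \<in> long_ray_set. long_ray_less x (\<alpha>, of_rat q)} \<subseteq> long_ray interior_of A"
      by (rule interior_of_maximal) (simp add: long_ray_def ray.openin_less[OF qS])
    moreover have "long_ray_less x (\<alpha>, of_rat q)"
      using q by (simp add: long_ray_less_def \<alpha>_def)
    ultimately have xA: "x \<in> long_ray interior_of A"
      using xS by blast
    have "{x \<in> long_ray_set. long_ray_less (\<alpha>, of_rat r) x} \<subseteq> B"
      unfolding B_def using ray.asym[OF rS] by blast
    then have "{x \<in> long_ray_set. long_ray_less (\<alpha>, of_rat r) x} \<subseteq> long_ray interior_of B"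
      by (rule interior_of_maximal) (simp add: long_ray_def ray.openin_greater[OF rS])
    moreover have "long_ray_less (\<alpha>, of_rat r) y"
      using r less by (auto simp: long_ray_less_def \<alpha>_def m_def split: if_splits)
    ultimately have yB: "y \<in> long_ray interior_of B"
      using yS by blast
    have "interior_separated long_ray x y A B"
      unfolding interior_separated_def using xA yB by blast
    then show ?thesis
      using lt AB by blast
  qed
  have "x \<in> long_ray_set" "y \<in> long_ray_set"
    using x y by (auto simp: long_ray_segment_def)
  then consider "long_ray_less x y" | "long_ray_less y x"
    using ray.total \<open>x \<noteq> y\<close> by blast
  then show ?thesis
  proof cases
    case 1
    then show ?thesis using main[OF x y] by blast
  next
    case 2
    then show ?thesis
      using main[OF y x] interior_separated_sym[of long_ray y x] by blast
  qed
qed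

theorem CSHP_long_ray: "CSHP long_ray"
proof (rule omega1.CSHP_criterion[where K = long_ray_segment and \<C> = long_ray_cuts])
  show "\<exists>\<alpha> \<in> Field omega1. L \<subseteq> long_ray_segment \<alpha>" if "compactin long_ray L" for L
    using compactin_long_ray_bounded[OF that] by blast
  show "|long_ray_cuts \<alpha>| <o omega1" for \<alpha>
    by (rule omega1.card_of_countable_less[OF countable_long_ray_cuts])
  show "\<exists>\<alpha>. ((\<alpha>, \<beta>) \<in> omega1 \<and> \<alpha> \<noteq> \<beta>) \<and> (\<exists>(A, B) \<in> long_ray_cuts \<alpha>. interior_separated long_ray x y A B)"
    if "\<exists>\<alpha>. (\<alpha>, \<beta>) \<in> omega1 \<and> \<alpha> \<noteq> \<beta>" "x \<in> long_ray_segment \<beta>" "y \<in> long_ray_segment \<beta>" "x \<noteq> y" for \<beta> x y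
  proof -
    have "\<beta> \<in> Field omega1"
      using that(1) omega1.in_Field by blast
    then show ?thesis
      using interior_separated_long_ray[OF that(2-4)] by (simp only: conj_assoc)
  qed
qed (rule Hausdorff_space_long_ray compactin_long_ray_segment long_ray_segment_mono
      functionally_separated_long_ray_cuts | assumption)+

section \<open>The long line\<close>

text \<open>The least ordinal paired with 0 is a least point, so the choice operator in the
  definition picks a genuine one.\<close>

lemma long_ray_zero:
  shows "long_ray_zero \<in> long_ray_set" and "\<And>q. q \<in> long_ray_set \<Longrightarrow> \<not> long_ray_less q long_ray_zero"
proof -
  obtain m where m: "m \<in> Field omega1" "\<And>a. a \<in> Field omega1 \<Longrightarrow> (m, a) \<in> omega1"
    using omega1.least_exists[OF subset_refl] omega1.infinite_Field by fastforce
  have "(m, 0) \<in> long_ray_set"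
    using m(1) by (simp add: long_ray_point)
  moreover have "(m, 0) = q \<or> long_ray_less (m, 0) q" if "q \<in> long_ray_set" for q
  proof (cases q)
    case (Pair a t)
    then have "(m, a) \<in> omega1" "0 \<le> t"
      using that m(2) by (auto simp: long_ray_set_def)
    then show ?thesis
      by (cases "m = a"; cases "t = 0") (simp_all add: Pair long_ray_less_def)
  qed
  ultimately have "\<exists>p. p \<in> long_ray_set \<and> (\<forall>q \<in> long_ray_set. p = q \<or> long_ray_less p q)"
    by blast
  from someI_ex[OF this]
  have *: "long_ray_zero \<in> long_ray_set" "\<forall>q \<in> long_ray_set. long_ray_zero = q \<or> long_ray_less long_ray_zero q"
    unfolding long_ray_zero_def by blast+
  then show "long_ray_zero \<in> long_ray_set"
    by blast
  show "\<not> long_ray_less q long_ray_zero" if "q \<in> long_ray_set" for q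
    using * that ray.asym ray.irrefl by metis
qed

lemma long_ray_zero_less:
  assumes "q \<in> long_ray_set" "q \<noteq> long_ray_zero"
  shows "long_ray_less long_ray_zero q"
  using assms long_ray_zero ray.total by metis

interpretation line: strict_linorder_on long_line_set long_line_less
proof
  have S: "snd x \<in> long_ray_set" if "x \<in> long_line_set" for x
    using that by (auto simp: long_line_set_def)
  show "\<not> long_line_less x x" if "x \<in> long_line_set" for x
    using ray.irrefl[OF S[OF that]] by (simp add: long_line_less_def)
  show "long_line_less x z" if "long_line_less x y" "long_line_less y z" for x y z
    using that long_ray_less_trans[of "snd x" "snd y" "snd z"] long_ray_less_trans[of "snd z" "snd y" "snd x"]
    unfolding long_line_less_def by blast
  show "long_line_less x y \<or> long_line_less y x"
    if "x \<in> long_line_set" "y \<in> long_line_set" "x \<noteq> y" for x y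
  proof (cases "fst x = fst y")
    case True
    then have "snd x \<noteq> snd y"
      using that(3) prod_eqI by blast
    then show ?thesis
      using True ray.total[OF S[OF that(1)] S[OF that(2)]] unfolding long_line_less_def by blast
  next
    case False
    then show ?thesis
      unfolding long_line_less_def by blast
  qed
qed

lemma topspace_long_line: "topspace long_line = long_line_set"
  unfolding long_line_def by (rule line.topspace_order_top)

lemma snd_long_line: "x \<in> long_line_set \<Longrightarrow> snd x \<in> long_ray_set"
  by (auto simp: long_line_set_def)

lemma long_line_True: "p \<in> long_ray_set \<Longrightarrow> (True, p) \<in> long_line_set"
  unfolding long_line_set_def by blast

lemma long_line_False: "p \<in> long_ray_set \<Longrightarrow> p \<noteq> long_ray_zero \<Longrightarrow> (False, p) \<in> long_line_set"
  unfolding long_line_set_def by blast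

text \<open>The positive and the negative part of a point of the long line; together they separate points.\<close>
definition long_line_part :: "bool \<Rightarrow> bool \<times> (nat set \<times> real) \<Rightarrow> nat set \<times> real" where
  "long_line_part c x = (if fst x = c then snd x else long_ray_zero)"

lemma long_line_part_in: "x \<in> long_line_set \<Longrightarrow> long_line_part c x \<in> long_ray_set"
  by (simp add: long_line_part_def snd_long_line long_ray_zero)

text \<open>Preimages of proper rays are rays of the line, reversed for the negative half. The
  endpoint zero is treated apart, as \<open>(False, long_ray_zero)\<close> is not a point of the
  line.\<close>

lemma continuous_map_long_line_part: "continuous_map long_line long_ray (long_line_part c)"
  unfolding long_ray_def
proof (rule ray.continuous_map_into_order_top)
  show "long_line_part c ` topspace long_line \<subseteq> long_ray_set"
    using long_line_part_in by (auto simp: topspace_long_line)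
  fix a assume a: "a \<in> long_ray_set"
  have nz: "\<not> long_ray_less q long_ray_zero" if "q \<in> long_ray_set" for q
    by (rule long_ray_zero(2)[OF that])
  have pos: "long_ray_less long_ray_zero a" if "a \<noteq> long_ray_zero"
    by (rule long_ray_zero_less[OF a that])
  show "openin long_line {x \<in> topspace long_line. long_ray_less (long_line_part c x) a}"
  proof (cases "a = long_ray_zero")
    case True
    then have "{x \<in> topspace long_line. long_ray_less (long_line_part c x) a} = {}"
      using nz long_line_part_in by (auto simp: topspace_long_line)
    then show ?thesis by (simp only: openin_empty)
  next
    case False
    show ?thesis
    proof (cases c)
      case True
      have "{x \<in> topspace long_line. long_ray_less (long_line_part c x) a}
          = {x \<in> long_line_set. long_line_less x (True, a)}"
        using True pos[OF False] by (auto simp: topspace_long_line long_line_less_def long_line_part_def)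
      then show ?thesis
        unfolding long_line_def using line.openin_less[OF long_line_True[OF a]] by simp
    next
      case c: False
      have "{x \<in> topspace long_line. long_ray_less (long_line_part c x) a}
          = {x \<in> long_line_set. long_line_less (False, a) x}"
        using c pos[OF False] by (auto simp: topspace_long_line long_line_less_def long_line_part_def)
      then show ?thesis
        unfolding long_line_def using line.openin_greater[OF long_line_False[OF a False]] by simp
    qed
  qed
  show "openin long_line {x \<in> topspace long_line. long_ray_less a (long_line_part c x)}"
  proof (cases c)
    case True
    have "{x \<in> topspace long_line. long_ray_less a (long_line_part c x)}
        = {x \<in> long_line_set. long_line_less (True, a) x}"
      using True nz[OF a] by (auto simp: topspace_long_line long_line_less_def long_line_part_def)
    then show ?thesis
      unfolding long_line_def using line.openin_greater[OF long_line_True[OF a]] by simp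
  next
    case c: False
    show ?thesis
    proof (cases "a = long_ray_zero")
      case True
      \<comment> \<open>The points with positive distance on the negative side are those below the
        glued point, which carries the tag True; so the ray is cut at
        \<open>(True, a)\<close>.\<close>
      have "long_ray_less a (snd x)" if "x \<in> long_line_set" "\<not> fst x" for x
      proof -
        have "snd x \<noteq> long_ray_zero"
          using that by (auto simp: long_line_set_def)
        then show ?thesis
          using long_ray_zero_less snd_long_line that(1) True by blast
      qed
      then have "{x \<in> topspace long_line. long_ray_less a (long_line_part c x)}
          = {x \<in> long_line_set. long_line_less x (True, a)}"
        using c nz[OF a] nz[OF snd_long_line] True
        by (auto simp: topspace_long_line long_line_less_def long_line_part_def)
      then show ?thesis
        unfolding long_line_def using line.openin_less[OF long_line_True[OF a]] by simp
    next
      case False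
      have "{x \<in> topspace long_line. long_ray_less a (long_line_part c x)}
          = {x \<in> long_line_set. long_line_less x (False, a)}"
        using c nz[OF a] by (auto simp: topspace_long_line long_line_less_def long_line_part_def)
      then show ?thesis
        unfolding long_line_def using line.openin_less[OF long_line_False[OF a False]] by simp
    qed
  qed
qed

text \<open>The tag is forced to True at zero, the only place where the glued point is
  represented.\<close>

definition long_line_emb :: "bool \<Rightarrow> nat set \<times> real \<Rightarrow> bool \<times> (nat set \<times> real)" where
  "long_line_emb c p = (c \<or> p = long_ray_zero, p)"

lemma continuous_map_long_line_emb: "continuous_map long_ray long_line (long_line_emb c)"
  unfolding long_line_def
proof (rule line.continuous_map_into_order_top)
  show "long_line_emb c ` topspace long_ray \<subseteq> long_line_set"
    by (auto simp: topspace_long_ray long_line_emb_def long_line_set_def)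
  fix a assume a: "a \<in> long_line_set"
  obtain d q where aq: "a = (d, q)" by (metis surj_pair)
  have q: "q \<in> long_ray_set" and dz: "\<not> d \<Longrightarrow> q \<noteq> long_ray_zero"
    using a by (auto simp: aq long_line_set_def)
  have less: "openin long_ray {x \<in> long_ray_set. long_ray_less x q}"
    unfolding long_ray_def by (rule ray.openin_less[OF q])
  have greater: "openin long_ray {x \<in> long_ray_set. long_ray_less q x}"
    unfolding long_ray_def by (rule ray.openin_greater[OF q])
  have all: "openin long_ray long_ray_set"
    using openin_topspace[of long_ray] by (simp add: topspace_long_ray)
  have nz: "\<not> long_ray_less p long_ray_zero" if "p \<in> long_ray_set" for p
    by (rule long_ray_zero(2)[OF that])
  have pos: "long_ray_less long_ray_zero p" if "p \<in> long_ray_set" "p \<noteq> long_ray_zero" for p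
    by (rule long_ray_zero_less[OF that])
  let ?L = "{x \<in> topspace long_ray. long_line_less (long_line_emb c x) a}"
  let ?G = "{x \<in> topspace long_ray. long_line_less a (long_line_emb c x)}"
  consider "c" "d" | "c" "\<not> d" | "\<not> c" "d" "q = long_ray_zero" | "\<not> c" "d" "q \<noteq> long_ray_zero" | "\<not> c" "\<not> d"
    by blast
  then have "openin long_ray ?L \<and> openin long_ray ?G"
  proof cases
    case 1
    then have "?L = {x \<in> long_ray_set. long_ray_less x q}" "?G = {x \<in> long_ray_set. long_ray_less q x}"
      by (auto simp: topspace_long_ray long_line_less_def long_line_emb_def aq)
    then show ?thesis using less greater by (simp only: openin_empty simp_thms)
  next
    case 2
    then have "?L = {}" "?G = long_ray_set"
      by (auto simp: topspace_long_ray long_line_less_def long_line_emb_def aq)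
    then show ?thesis using all by (simp only: openin_empty simp_thms)
  next
    \<comment> \<open>Here \<open>a\<close> is the glued point: the whole reversed copy lies below
      it except for that point itself.\<close>
    case 3
    then have "?L = {x \<in> long_ray_set. long_ray_less q x}" "?G = {}"
      using pos nz ray.irrefl[OF long_ray_zero(1)]
      by (auto simp: topspace_long_ray long_line_less_def long_line_emb_def aq)
    then show ?thesis using greater by (simp only: openin_empty simp_thms)
  next
    case 4
    then have "?L = long_ray_set" "?G = {}"
      using pos[OF q] nz[OF q]
      by (auto simp: topspace_long_ray long_line_less_def long_line_emb_def aq)
    then show ?thesis using all by (simp only: openin_empty simp_thms)
  next
    case 5
    then have "?L = {x \<in> long_ray_set. long_ray_less q x}" "?G = {x \<in> long_ray_set. long_ray_less x q}"
      using nz[OF q] pos[OF q dz]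
      by (auto simp: topspace_long_ray long_line_less_def long_line_emb_def aq)
    then show ?thesis using less greater by (simp only: openin_empty simp_thms)
  qed
  then show "openin long_ray ?L" "openin long_ray ?G"
    by blast+
qed

definition long_line_segment :: "nat set \<Rightarrow> (bool \<times> (nat set \<times> real)) set" where
  "long_line_segment \<alpha> = {x \<in> long_line_set. snd x \<in> long_ray_segment \<alpha>}"

definition long_line_cuts :: "nat set \<Rightarrow> ((bool \<times> (nat set \<times> real)) set \<times> (bool \<times> (nat set \<times> real)) set) set" where
  "long_line_cuts \<alpha> = (\<Union>c. pullback_pair long_line (long_line_part c) ` long_ray_cuts \<alpha>)"

lemma long_ray_zero_in_segment:
  assumes "\<alpha> \<in> Field omega1"
  shows "long_ray_zero \<in> long_ray_segment \<alpha>"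
  using long_ray_zero long_ray_point[OF assms, of 0] by (simp add: long_ray_segment_def)

text \<open>Compactness is inherited from the ray, as the symmetric segment is the union of the
  images of a ray segment under the two embeddings.\<close>

lemma compactin_long_line_segment:
  assumes "\<alpha> \<in> Field omega1"
  shows "compactin long_line (long_line_segment \<alpha>)"
proof -
  have "compactin long_line (long_line_emb c ` long_ray_segment \<alpha>)" for c
    by (rule image_compactin[OF compactin_long_ray_segment[OF assms] continuous_map_long_line_emb])
  then have "compactin long_line (long_line_emb True ` long_ray_segment \<alpha> \<union> long_line_emb False ` long_ray_segment \<alpha>)"
    by (intro compactin_Un)
  moreover have "long_line_segment \<alpha> = long_line_emb True ` long_ray_segment \<alpha> \<union> long_line_emb False ` long_ray_segment \<alpha>"
  proof
    show "long_line_segment \<alpha> \<subseteq> long_line_emb True ` long_ray_segment \<alpha> \<union> long_line_emb False ` long_ray_segment \<alpha>"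
    proof
      fix x assume x: "x \<in> long_line_segment \<alpha>"
      then have "x = long_line_emb (fst x) (snd x)"
        by (auto simp: long_line_segment_def long_line_emb_def long_line_set_def)
      moreover have "snd x \<in> long_ray_segment \<alpha>"
        using x by (simp add: long_line_segment_def)
      ultimately show "x \<in> long_line_emb True ` long_ray_segment \<alpha> \<union> long_line_emb False ` long_ray_segment \<alpha>"
        by (cases "fst x") auto
    qed
    show "long_line_emb True ` long_ray_segment \<alpha> \<union> long_line_emb False ` long_ray_segment \<alpha> \<subseteq> long_line_segment \<alpha>"
      by (auto simp: long_line_segment_def long_line_emb_def long_line_set_def long_ray_segment_def)
  qed
  ultimately show ?thesis by simp
qed

theorem CSHP_long_line: "CSHP long_line"
proof (rule omega1.CSHP_criterion[where K = long_line_segment and \<C> = long_line_cuts])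
  show "Hausdorff_space long_line"
    unfolding long_line_def by (rule line.Hausdorff_space_order_top)
  show "compactin long_line (long_line_segment \<alpha>)" if "\<alpha> \<in> Field omega1" for \<alpha>
    by (rule compactin_long_line_segment[OF that])
  show "long_line_segment \<alpha> \<subseteq> long_line_segment \<beta>" if "(\<alpha>, \<beta>) \<in> omega1" for \<alpha> \<beta>
    using long_ray_segment_mono[OF that] unfolding long_line_segment_def by blast
  show "|long_line_cuts \<alpha>| <o omega1" for \<alpha>
  proof (rule omega1.card_of_countable_less)
    show "countable (long_line_cuts \<alpha>)"
      unfolding long_line_cuts_def
      by (intro countable_UN countable_image countable_long_ray_cuts) simp
  qed
  show "functionally_separated long_line A B"
    if \<alpha>: "\<alpha> \<in> Field omega1" and cut: "(A, B) \<in> long_line_cuts \<alpha>" for \<alpha> A B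
  proof -
    obtain c P where P: "P \<in> long_ray_cuts \<alpha>" and AB: "(A, B) = pullback_pair long_line (long_line_part c) P"
      using cut unfolding long_line_cuts_def by blast
    have "functionally_separated long_ray (fst P) (snd P)"
      using functionally_separated_long_ray_cuts[OF \<alpha>, of "fst P" "snd P"] P by simp
    from functionally_separated_pullback[OF continuous_map_long_line_part this] show ?thesis
      using AB by (simp add: pullback_pair_def)
  qed
  show "\<exists>\<alpha> \<in> Field omega1. L \<subseteq> long_line_segment \<alpha>" if L: "compactin long_line L" for L
  proof -
    have "compactin long_ray (long_line_part c ` L)" for c
      by (rule image_compactin[OF L continuous_map_long_line_part])
    then have "compactin long_ray (long_line_part True ` L \<union> long_line_part False ` L)"
      by (intro compactin_Un)
    from compactin_long_ray_bounded[OF this] obtain \<alpha> where \<alpha>: "\<alpha> \<in> Field omega1"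
        and sub: "long_line_part True ` L \<union> long_line_part False ` L \<subseteq> long_ray_segment \<alpha>"
      by blast
    have "L \<subseteq> long_line_set"
      using compactin_subset_topspace[OF L] by (simp add: topspace_long_line)
    moreover have "snd x \<in> long_ray_segment \<alpha>" if "x \<in> L" for x
    proof -
      have "snd x = long_line_part (fst x) x"
        by (simp add: long_line_part_def)
      then show ?thesis
        using sub that by (cases "fst x") auto
    qed
    ultimately have "L \<subseteq> long_line_segment \<alpha>"
      unfolding long_line_segment_def by blast
    then show ?thesis
      using \<alpha> by blast
  qed
  show "\<exists>\<alpha>. ((\<alpha>, \<beta>) \<in> omega1 \<and> \<alpha> \<noteq> \<beta>) \<and> (\<exists>(A, B) \<in> long_line_cuts \<alpha>. interior_separated long_line x y A B)"
    if lim: "\<exists>\<alpha>. (\<alpha>, \<beta>) \<in> omega1 \<and> \<alpha> \<noteq> \<beta>" and x: "x \<in> long_line_segment \<beta>"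
      and y: "y \<in> long_line_segment \<beta>" and neq: "x \<noteq> y" for \<beta> x y
  proof -
    have \<beta>: "\<beta> \<in> Field omega1"
      using lim omega1.in_Field by blast
    have xS: "x \<in> long_line_set" and yS: "y \<in> long_line_set"
      using x y by (auto simp: long_line_segment_def)
    \<comment> \<open>On the same half, that half distinguishes the points. On opposite halves the
      negative part does, being nonzero for exactly one of them.\<close>
    have "\<exists>c. long_line_part c x \<noteq> long_line_part c y"
    proof (cases "fst x = fst y")
      case True
      then have "snd x \<noteq> snd y"
        using neq prod_eqI by blast
      then show ?thesis
        using True by (intro exI[of _ "fst x"]) (simp add: long_line_part_def)
    next
      case False
      then show ?thesis
        using xS yS by (intro exI[of _ False]) (auto simp: long_line_part_def long_line_set_def)
    qed
    then obtain c where c: "long_line_part c x \<noteq> long_line_part c y" ..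
    have part: "long_line_part c z \<in> long_ray_segment \<beta>" if "z \<in> long_line_segment \<beta>" for z
      using that long_ray_zero_in_segment[OF \<beta>] by (simp add: long_line_part_def long_line_segment_def)
    obtain \<alpha> A B where \<alpha>: "(\<alpha>, \<beta>) \<in> omega1 \<and> \<alpha> \<noteq> \<beta>" and AB: "(A, B) \<in> long_ray_cuts \<alpha>"
        and sep: "interior_separated long_ray (long_line_part c x) (long_line_part c y) A B"
      using interior_separated_long_ray[OF part[OF x] part[OF y] c \<beta>] by blast
    have "interior_separated long_line x y {x \<in> topspace long_line. long_line_part c x \<in> A}
        {x \<in> topspace long_line. long_line_part c x \<in> B}"
      by (rule interior_separated_pullback[OF continuous_map_long_line_part _ _ sep])
         (simp_all add: topspace_long_line xS yS)
    moreover have "({x \<in> topspace long_line. long_line_part c x \<in> A},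
        {x \<in> topspace long_line. long_line_part c x \<in> B}) \<in> long_line_cuts \<alpha>"
      unfolding long_line_cuts_def using AB by (intro UN_I[of c] image_eqI[of _ _ "(A, B)"]) (auto simp: pullback_pair_def)
    ultimately show ?thesis
      using \<alpha> by blast
  qed
qed

section \<open>Products of ordinals\<close>

lemma Well_order_facts:
  assumes "Well_order r"
  shows "\<And>x. x \<in> Field r \<Longrightarrow> (x, x) \<in> r"
    and "\<And>x y z. (x, y) \<in> r \<Longrightarrow> (y, z) \<in> r \<Longrightarrow> (x, z) \<in> r"
    and "\<And>x y. (x, y) \<in> r \<Longrightarrow> (y, x) \<in> r \<Longrightarrow> x = y"
    and "\<And>x y. x \<in> Field r \<Longrightarrow> y \<in> Field r \<Longrightarrow> (x, y) \<in> r \<or> (y, x) \<in> r"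
    and "\<And>A. A \<subseteq> Field r \<Longrightarrow> A \<noteq> {} \<Longrightarrow> \<exists>m \<in> A. \<forall>a \<in> A. (m, a) \<in> r"
proof -
  have wo: "wo_rel r"
    using assms by (simp add: wo_rel_def)
  show "(x, x) \<in> r" if "x \<in> Field r" for x
    using wo_rel.REFL[OF wo] that by (simp add: refl_on_def)
  show "(x, z) \<in> r" if "(x, y) \<in> r" "(y, z) \<in> r" for x y z
    using wo_rel.TRANS[OF wo] that by (rule transD)
  show "x = y" if "(x, y) \<in> r" "(y, x) \<in> r" for x y
    using wo_rel.ANTISYM[OF wo] that by (rule antisymD)
  show "(x, y) \<in> r \<or> (y, x) \<in> r" if "x \<in> Field r" "y \<in> Field r" for x y
    using wo_rel.TOTALS[OF wo] that by blast
  show "\<exists>m \<in> A. \<forall>a \<in> A. (m, a) \<in> r" if "A \<subseteq> Field r" "A \<noteq> {}" for A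
    using wo_rel.minim_in[OF wo that] wo_rel.minim_least[OF wo that(1)] by blast
qed

section \<open>A single ordinal: compact initial segments and clopen cuts\<close>

locale ordinal_space =
  fixes r :: "'a rel"
  assumes Well_order: "Well_order r"
begin

lemmas le_refl = Well_order_facts(1)[OF Well_order]
lemmas le_trans = Well_order_facts(2)[OF Well_order]
lemmas le_antisym = Well_order_facts(3)[OF Well_order]
lemmas le_total = Well_order_facts(4)[OF Well_order]
lemmas least_exists = Well_order_facts(5)[OF Well_order]

lemma not_less_iff: "x \<in> Field r \<Longrightarrow> y \<in> Field r \<Longrightarrow> \<not> ((y, x) \<in> r \<and> y \<noteq> x) \<longleftrightarrow> (x, y) \<in> r"
  using le_total[of x y] le_antisym[of x y] le_refl[of x] by blast

sublocale strict_linorder_on "Field r" "\<lambda>x y. (x, y) \<in> r \<and> x \<noteq> y"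
proof
  show "(x, z) \<in> r \<and> x \<noteq> z" if "(x, y) \<in> r \<and> x \<noteq> y" "(y, z) \<in> r \<and> y \<noteq> z" for x y z
    using that le_trans[of x y z] le_antisym[of x y] by blast
  show "(x, y) \<in> r \<and> x \<noteq> y \<or> (y, x) \<in> r \<and> y \<noteq> x" if "x \<in> Field r" "y \<in> Field r" "x \<noteq> y" for x y
    using le_total[OF that(1,2)] that(3) by blast
qed blast

lemma topspace_ord_top: "topspace (ord_top r) = Field r"
  unfolding ord_top_def by (rule topspace_order_top)

lemma Hausdorff_space_ord_top: "Hausdorff_space (ord_top r)"
  unfolding ord_top_def by (rule Hausdorff_space_order_top)

lemma compactin_ord_top_le:
  assumes b: "b \<in> Field r"
  shows "compactin (ord_top r) {x \<in> Field r. (x, b) \<in> r}"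
proof -
  have "compactin (ord_top r) {x \<in> Field r. \<not> ((b, x) \<in> r \<and> b \<noteq> x)}"
    unfolding ord_top_def
  proof (rule compactin_initial_segment[OF b])
    fix L assume L: "L \<subseteq> {x \<in> Field r. \<not> ((b, x) \<in> r \<and> b \<noteq> x)}"
    define U where "U = {u \<in> Field r. \<forall>a \<in> L. \<not> ((u, a) \<in> r \<and> u \<noteq> a)}"
    have "b \<in> U"
      using b L unfolding U_def by blast
    then obtain s where s: "s \<in> U" "\<And>u. u \<in> U \<Longrightarrow> (s, u) \<in> r"
      using least_exists[of U] unfolding U_def by blast
    have sF: "s \<in> Field r"
      using s(1) unfolding U_def by blast
    moreover have "\<not> ((b, s) \<in> r \<and> b \<noteq> s)"
      using s(2)[OF \<open>b \<in> U\<close>] le_antisym[of s b] by blast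
    moreover have "\<exists>a \<in> L. (t, a) \<in> r \<and> t \<noteq> a" if "t \<in> Field r" "(t, s) \<in> r \<and> t \<noteq> s" for t
    proof (rule ccontr)
      assume "\<not> ?thesis"
      then have "t \<in> U"
        using that(1) unfolding U_def by blast
      then show False
        using s(2) that(2) le_antisym[of s t] by blast
    qed
    ultimately show "\<exists>s \<in> Field r. \<not> ((b, s) \<in> r \<and> b \<noteq> s) \<and> (\<forall>a \<in> L. \<not> ((s, a) \<in> r \<and> s \<noteq> a)) \<and>
        (\<forall>t \<in> Field r. (t, s) \<in> r \<and> t \<noteq> s \<longrightarrow> (\<exists>a \<in> L. (t, a) \<in> r \<and> t \<noteq> a))"
      using s(1) unfolding U_def by blast
  qed
  moreover have "{x \<in> Field r. \<not> ((b, x) \<in> r \<and> b \<noteq> x)} = {x \<in> Field r. (x, b) \<in> r}"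
    using not_less_iff[OF _ b] by blast
  ultimately show ?thesis
    by simp
qed

definition cut :: "'a \<Rightarrow> 'a set \<times> 'a set" where
  "cut c = ({x \<in> Field r. (x, c) \<in> r}, {x \<in> Field r. (x, c) \<notin> r})"

lemma openin_cut:
  assumes c: "c \<in> Field r"
  shows "openin (ord_top r) {x \<in> Field r. (x, c) \<in> r}" "openin (ord_top r) {x \<in> Field r. (x, c) \<notin> r}"
proof -
  show "openin (ord_top r) {x \<in> Field r. (x, c) \<in> r}"
  proof (cases "\<exists>d \<in> Field r. (d, c) \<notin> r")
    case False
    then have "{x \<in> Field r. (x, c) \<in> r} = topspace (ord_top r)"
      unfolding topspace_ord_top by blast
    then show ?thesis
      by (simp only: openin_topspace)
  next
    case True
    \<comment> \<open>\<open>d\<close> is the successor of \<open>c\<close>, so the segment up to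
      \<open>c\<close> is the open ray below \<open>d\<close>.\<close>
    then obtain d where d: "d \<in> Field r" "(d, c) \<notin> r"
        and least: "\<And>e. e \<in> Field r \<Longrightarrow> (e, c) \<notin> r \<Longrightarrow> (d, e) \<in> r"
      using least_exists[of "{d \<in> Field r. (d, c) \<notin> r}"] by blast
    have "(x, c) \<in> r \<longleftrightarrow> (x, d) \<in> r \<and> x \<noteq> d" if "x \<in> Field r" for x
      using that d least[of x] le_trans[of x c d] le_total[OF d(1) c] le_antisym[of x d] by blast
    then have "{x \<in> Field r. (x, c) \<in> r} = {x \<in> Field r. (x, d) \<in> r \<and> x \<noteq> d}"
      by blast
    then show ?thesis
      unfolding ord_top_def using openin_less[OF d(1)] by simp
  qed
  have "{x \<in> Field r. (x, c) \<notin> r} = {x \<in> Field r. (c, x) \<in> r \<and> c \<noteq> x}"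
    using not_less_iff[OF _ c] by blast
  then show "openin (ord_top r) {x \<in> Field r. (x, c) \<notin> r}"
    unfolding ord_top_def using openin_greater[OF c] by simp
qed

text \<open>Both halves of a cut are open, so the 0-1 indicator is continuous. In contrast to the
  ray, no gap between the halves has to be left.\<close>

lemma functionally_separated_cut:
  assumes c: "c \<in> Field r" and "(A, B) = cut c"
  shows "functionally_separated (ord_top r) A B"
proof -
  have AB: "A = {x \<in> Field r. (x, c) \<in> r}" "B = {x \<in> Field r. (x, c) \<notin> r}"
    using assms(2) by (simp_all add: cut_def)
  define f :: "'a \<Rightarrow> real" where "f x = (if (x, c) \<in> r then 0 else 1)" for x
  have "continuous_map (ord_top r) euclideanreal f"
    unfolding continuous_map_alt
  proof (intro conjI allI impI)
    fix U :: "real set"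
    have eq: "f -` U \<inter> topspace (ord_top r) = (if 0 \<in> U then A else {}) \<union> (if 1 \<in> U then B else {})"
      unfolding topspace_ord_top AB f_def by (auto split: if_splits)
    show "openin (ord_top r) (f -` U \<inter> topspace (ord_top r))"
      unfolding eq by (rule openin_Un) (use openin_cut[OF c] in \<open>simp_all add: AB\<close>)
  qed simp
  then have "continuous_map (ord_top r) (top_of_set {0..1}) f"
    by (auto simp: continuous_map_in_subtopology f_def)
  then have "f \<in> cb_funs (ord_top r)"
    by (simp add: cb_funs_def)
  then show ?thesis
    unfolding functionally_separated_def by (rule bexI[rotated]) (simp add: AB f_def)
qed

text \<open>Cutting at the smaller point itself is what later makes the index of the separating pair
  strictly smaller than that of the compact set.\<close>

lemma interior_separated_cut_less:
  assumes less: "(x, y) \<in> r" "x \<noteq> y"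
  shows "interior_separated (ord_top r) x y (fst (cut x)) (snd (cut x))"
proof -
  have F: "x \<in> Field r" "y \<in> Field r"
    using less(1) by (auto intro: FieldI1 FieldI2)
  have "x \<in> {z \<in> Field r. (z, x) \<in> r}" "y \<in> {z \<in> Field r. (z, x) \<notin> r}"
    using F le_refl less le_antisym by blast+
  then show ?thesis
    unfolding interior_separated_def cut_def fst_conv snd_conv
    using interior_of_openin[OF openin_cut(1)[OF F(1)]] interior_of_openin[OF openin_cut(2)[OF F(1)]] by simp
qed

end

section \<open>Tagged copies of ordinals and their finite products\<close>

lemma map_prod_image_dir_image: "map_prod f f ` r = dir_image r f"
  by (auto simp: dir_image_def)

lemma Well_order_inj_image:
  assumes "Well_order r" "inj f"
  shows "Well_order (map_prod f f ` r)"
proof -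
  have "inj_on f (Field r)"
    using assms(2) inj_on_subset by blast
  then show ?thesis
    unfolding map_prod_image_dir_image by (rule Well_order_dir_image[OF assms(1)])
qed

lemma Field_inj_image: "Field (map_prod f f ` r) = f ` Field r"
  unfolding map_prod_image_dir_image by (rule dir_image_Field)

lemma inj_image_iff: "inj f \<Longrightarrow> (f x, f y) \<in> map_prod f f ` r \<longleftrightarrow> (x, y) \<in> r"
  by (auto simp: inj_eq)

theorem CSHP_ordinal_product:
  fixes \<kappa> :: "'a rel" and ls :: "'b rel list"
  assumes "regular_uncountable \<kappa>"
    and ls: "\<And>l. l \<in> set ls \<Longrightarrow> successor_ordinal l" "\<And>l. l \<in> set ls \<Longrightarrow> l <o \<kappa>"
  shows "CSHP (ordinal_product \<kappa> n ls)"
proof -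
  interpret \<kappa>: regular_uncountable \<kappa>
    by fact
  define N where "N = n + length ls"
  define \<kappa>' :: "('a + 'b) rel" where "\<kappa>' = map_prod Inl Inl ` \<kappa>"
  define \<mu> :: "nat \<Rightarrow> ('a + 'b) rel" where "\<mu> i = map_prod Inr Inr ` (ls ! (i - n))" for i
  define R where "R i = (if i < n then \<kappa>' else \<mu> i)" for i
  define X where "X = product_topology (\<lambda>i. ord_top (R i)) {..<N}"
  have X_eq: "ordinal_product \<kappa> n ls = X"
    unfolding ordinal_product_def X_def R_def \<kappa>'_def \<mu>_def N_def by (simp add: if_distrib)
  have wo\<kappa>: "Well_order \<kappa>"
    using \<kappa>.card_order by (simp add: card_order_on_def)
  have l_in: "ls ! (i - n) \<in> set ls" if "i \<in> {..<N}" "\<not> i < n" for i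
    using that by (intro nth_mem) (auto simp: N_def)
  have R: "ordinal_space (R i)" if "i \<in> {..<N}" for i
  proof
    show "Well_order (R i)"
      using wo\<kappa> ls(1)[OF l_in[OF that]]
      by (simp add: R_def \<kappa>'_def \<mu>_def Well_order_inj_image successor_ordinal_def)
  qed
  have Field\<kappa>': "Field \<kappa>' = Inl ` Field \<kappa>"
    unfolding \<kappa>'_def by (rule Field_inj_image)
  have \<kappa>'_iff: "(Inl a, Inl b) \<in> \<kappa>' \<longleftrightarrow> (a, b) \<in> \<kappa>" for a b
    unfolding \<kappa>'_def by (rule inj_image_iff) simp
  have topX: "topspace X = PiE {..<N} (\<lambda>i. Field (R i))"
    unfolding X_def topspace_product_topology
    by (rule PiE_cong) (simp add: ordinal_space.topspace_ord_top[OF R])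
  have proj: "continuous_map X (ord_top (R i)) (\<lambda>x. x i)" if "i \<in> {..<N}" for i
    unfolding X_def by (rule continuous_map_product_projection[OF that])
  have coord: "x i \<in> Field (R i)" if "x \<in> topspace X" "i \<in> {..<N}" for x i
    using that unfolding topX by (rule PiE_mem)
  \<comment> \<open>Only the coordinates over \<kappa> are truncated at \<open>a\<close>; the
    successor ordinals are compact as they stand.\<close>
  define F where "F a i = (if i < n then {y \<in> Field (R i). (y, Inl a) \<in> R i} else Field (R i))" for a i
  define K where "K a = PiE {..<N} (F a)" for a
  \<comment> \<open>A coordinate over \<kappa> contributes to index \<open>a\<close> the single cut
    at \<open>a\<close>. A successor ordinal contributes all its cuts to every index, which keeps
    the family small because that ordinal is smaller than \<kappa>.\<close>
  define \<C> where "\<C> a = (\<lambda>i. pullback_pair X (\<lambda>x. x i) (ordinal_space.cut (R i) (Inl a))) ` {..<n} \<union>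
     (\<Union>i \<in> {n..<N}. (\<lambda>c. pullback_pair X (\<lambda>x. x i) (ordinal_space.cut (R i) c)) ` Field (R i))" for a
  have FieldR: "Field (R i) = Inl ` Field \<kappa>" "R i = \<kappa>'" if "i < n" for i
    using that Field\<kappa>' by (simp_all add: R_def)
  have KX: "K a \<subseteq> topspace X" for a
    unfolding K_def topX by (rule PiE_mono) (simp add: F_def)
  have "CSHP X"
  proof (rule \<kappa>.CSHP_criterion[where K = K and \<C> = \<C>])
    show "Hausdorff_space X"
      unfolding X_def Hausdorff_space_product_topology
      using ordinal_space.Hausdorff_space_ord_top[OF R] by blast
    show "compactin X (K a)" if a: "a \<in> Field \<kappa>" for a
    proof -
      have "compactin (ord_top (R i)) (F a i)" if i: "i \<in> {..<N}" for i
      proof (cases "i < n")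
        case True
        then have "Inl a \<in> Field (R i)"
          using a FieldR by blast
        then show ?thesis
          using ordinal_space.compactin_ord_top_le[OF R[OF i]] True by (simp add: F_def)
      next
        case False
        let ?l = "ls ! (i - n)"
        \<comment> \<open>The largest element of the successor ordinal exhibits the whole factor as
          a compact initial segment.\<close>
        obtain m where m: "m \<in> Field ?l" "\<And>x. x \<in> Field ?l \<Longrightarrow> (x, m) \<in> ?l"
          using ls(1)[OF l_in[OF i False]] unfolding successor_ordinal_def by blast
        have Ri: "R i = map_prod Inr Inr ` ?l"
          using False by (simp add: R_def \<mu>_def)
        have Fi: "Field (R i) = Inr ` Field ?l"
          unfolding Ri by (rule Field_inj_image)
        have "(Inr x, Inr m) \<in> R i" if "x \<in> Field ?l" for x
          unfolding Ri using m(2)[OF that] by (simp add: inj_image_iff)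
        then have "F a i = {x \<in> Field (R i). (x, Inr m) \<in> R i}"
          using False unfolding F_def Fi by auto
        then show ?thesis
          using ordinal_space.compactin_ord_top_le[OF R[OF i], of "Inr m"] m(1) Fi by simp
      qed
      then show ?thesis
        unfolding X_def K_def compactin_PiE by blast
    qed
    show "K a \<subseteq> K b" if "(a, b) \<in> \<kappa>" for a b
      unfolding K_def
    proof (rule PiE_mono)
      fix i assume i: "i \<in> {..<N}"
      have "(y, Inl b) \<in> \<kappa>'" if "(y, Inl a) \<in> \<kappa>'" "i < n" for y
        using ordinal_space.le_trans[OF R[OF i], of y "Inl a" "Inl b"] that \<open>(a, b) \<in> \<kappa>\<close> \<kappa>'_iff FieldR(2)
        by simp
      then show "F a i \<subseteq> F b i"
        using FieldR(2) by (auto simp: F_def)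
    qed
    show "\<exists>a \<in> Field \<kappa>. L \<subseteq> K a" if L: "compactin X L" for L
    proof -
      have "\<exists>a. a \<in> Field \<kappa> \<and> (\<forall>x \<in> L. (x i, Inl a) \<in> R i)" if "i < n" for i
      proof -
        have i: "i \<in> {..<N}"
          using that by (simp add: N_def)
        interpret Ri: ordinal_space "R i"
          by (rule R[OF i])
        have "compactin (ord_top (R i)) ((\<lambda>x. x i) ` L)"
          by (rule image_compactin[OF L proj[OF i]])
        moreover have "Field (R i) \<noteq> {}"
          using \<kappa>.infinite_Field FieldR(1)[OF that] by fastforce
        moreover have "\<exists>d \<in> Field (R i). (y, d) \<in> R i \<and> y \<noteq> d" if y: "y \<in> Field (R i)" for y
        proof -
          obtain a where a: "y = Inl a" "a \<in> Field \<kappa>"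
            using y FieldR(1)[OF \<open>i < n\<close>] by blast
          then obtain b where "(a, b) \<in> \<kappa>" "a \<noteq> b"
            using \<kappa>.exists_greater by blast
          then show ?thesis
            using a FieldR[OF \<open>i < n\<close>] \<kappa>'_iff \<kappa>.in_Field by (intro bexI[of _ "Inl b"]) auto
        qed
        ultimately have "\<exists>d \<in> Field (R i). \<forall>y \<in> (\<lambda>x. x i) ` L. (y, d) \<in> R i \<and> y \<noteq> d"
          unfolding ord_top_def by (intro Ri.compactin_bounded[OF _ subset_refl])
        then obtain d where d: "d \<in> Field (R i)" "\<And>x. x \<in> L \<Longrightarrow> (x i, d) \<in> R i"
          by blast
        then obtain a where "d = Inl a" "a \<in> Field \<kappa>"
          using FieldR(1)[OF \<open>i < n\<close>] by blast
        then show ?thesis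
          using d(2) by blast
      qed
      then obtain b where b: "\<And>i. i < n \<Longrightarrow> b i \<in> Field \<kappa>" "\<And>i x. i < n \<Longrightarrow> x \<in> L \<Longrightarrow> (x i, Inl (b i)) \<in> R i"
        by metis
      have "\<exists>a \<in> Field \<kappa>. \<forall>c \<in> b ` {..<n}. (c, a) \<in> \<kappa>"
      proof (rule \<kappa>.bounded_if_small)
        show "b ` {..<n} \<subseteq> Field \<kappa>"
          using b(1) by auto
        show "|b ` {..<n}| <o \<kappa>"
          by (rule \<kappa>.card_of_countable_less) simp
      qed
      then obtain a where a: "a \<in> Field \<kappa>" "\<And>i. i < n \<Longrightarrow> (b i, a) \<in> \<kappa>"
        by auto
      have "x \<in> K a" if "x \<in> L" for x
      proof -
        have x: "x \<in> topspace X"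
          using that compactin_subset_topspace[OF L] by blast
        have "x i \<in> F a i" if i: "i \<in> {..<N}" for i
        proof (cases "i < n")
          case True
          have "(Inl (b i), Inl a) \<in> R i"
            using a(2)[OF True] \<kappa>'_iff FieldR(2)[OF True] by simp
          then have "(x i, Inl a) \<in> R i"
            by (rule ordinal_space.le_trans[OF R[OF i] b(2)[OF True \<open>x \<in> L\<close>]])
          then show ?thesis
            using True coord[OF x i] by (simp add: F_def)
        next
          case False
          then show ?thesis
            using coord[OF x i] by (simp add: F_def)
        qed
        then show ?thesis
          using x unfolding K_def topX by (auto simp: PiE_iff)
      qed
      then show ?thesis
        using a(1) by blast
    qed
    show "|\<C> a| <o \<kappa>" for a
      unfolding \<C>_def
    proof (rule card_of_Un_ordLess_infinite_Field[OF \<kappa>.infinite_Field \<kappa>.card_order])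
      show "|(\<lambda>i. pullback_pair X (\<lambda>x. x i) (ordinal_space.cut (R i) (Inl a))) ` {..<n}| <o \<kappa>"
        by (rule \<kappa>.card_of_countable_less) simp
      show "|\<Union>i \<in> {n..<N}. (\<lambda>c. pullback_pair X (\<lambda>x. x i) (ordinal_space.cut (R i) c)) ` Field (R i)| <o \<kappa>"
      proof (rule stable_UNION[OF \<kappa>.stable])
        show "|{n..<N}| <o \<kappa>"
          by (rule \<kappa>.card_of_countable_less) simp
        fix i assume "i \<in> {n..<N}"
        then have i: "i \<in> {..<N}" "\<not> i < n"
          by auto
        let ?l = "ls ! (i - n)"
        have "Well_order ?l" "?l <o \<kappa>"
          using ls l_in[OF i] unfolding successor_ordinal_def by blast+
        then have "|Field ?l| <o \<kappa>"
          using card_of_least ordLeq_ordLess_trans by blast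
        moreover have "Field (R i) = Inr ` Field ?l"
          using i by (simp add: R_def \<mu>_def Field_inj_image)
        ultimately have "|Field (R i)| <o \<kappa>"
          using card_of_image[of Inr "Field ?l"] ordLeq_ordLess_trans by simp
        then show "|(\<lambda>c. pullback_pair X (\<lambda>x. x i) (ordinal_space.cut (R i) c)) ` Field (R i)| <o \<kappa>"
          using card_of_image ordLeq_ordLess_trans by blast
      qed
    qed
    show "functionally_separated X A B" if a: "a \<in> Field \<kappa>" and AB: "(A, B) \<in> \<C> a" for a A B
    proof -
      obtain i c where i: "i \<in> {..<N}" and c: "c \<in> Field (R i)"
          and eq: "(A, B) = pullback_pair X (\<lambda>x. x i) (ordinal_space.cut (R i) c)"
      proof -
        consider i where "i < n" "(A, B) = pullback_pair X (\<lambda>x. x i) (ordinal_space.cut (R i) (Inl a))"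
          | i c where "i \<in> {n..<N}" "c \<in> Field (R i)" "(A, B) = pullback_pair X (\<lambda>x. x i) (ordinal_space.cut (R i) c)"
          using AB unfolding \<C>_def by blast
        then show thesis
        proof cases
          case 1
          show thesis
            by (rule that[OF _ _ 1(2)]) (use 1(1) a FieldR(1)[OF 1(1)] in \<open>auto simp: N_def\<close>)
        next
          case 2
          show thesis
            by (rule that[OF _ 2(2,3)]) (use 2(1) in auto)
        qed
      qed
      have "functionally_separated (ord_top (R i)) (fst (ordinal_space.cut (R i) c)) (snd (ordinal_space.cut (R i) c))"
        by (rule ordinal_space.functionally_separated_cut[OF R[OF i] c]) simp
      from functionally_separated_pullback[OF proj[OF i] this] show ?thesis
        using eq by (simp add: pullback_pair_def)
    qed
    show "\<exists>a. ((a, b) \<in> \<kappa> \<and> a \<noteq> b) \<and> (\<exists>(A, B) \<in> \<C> a. interior_separated X x y A B)"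
      if lim: "\<exists>a. (a, b) \<in> \<kappa> \<and> a \<noteq> b" and xK: "x \<in> K b" and yK: "y \<in> K b" and neq: "x \<noteq> y" for b x y
    proof -
      have main: "\<exists>a. ((a, b) \<in> \<kappa> \<and> a \<noteq> b) \<and> (\<exists>(A, B) \<in> \<C> a. interior_separated X x y A B)"
        if xK: "x \<in> K b" and yK: "y \<in> K b" and i: "i \<in> {..<N}" and less: "(x i, y i) \<in> R i" "x i \<noteq> y i" for x y i
      proof -
        have X: "x \<in> topspace X" "y \<in> topspace X"
          using xK yK KX by blast+
        let ?P = "pullback_pair X (\<lambda>x. x i) (ordinal_space.cut (R i) (x i))"
        have "interior_separated X x y (fst ?P) (snd ?P)"
          using interior_separated_pullback[OF proj[OF i] X, of "fst (ordinal_space.cut (R i) (x i))"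
              "snd (ordinal_space.cut (R i) (x i))"]
            ordinal_space.interior_separated_cut_less[OF R[OF i] less]
          by (simp add: pullback_pair_def)
        then have sep: "\<exists>(A, B) \<in> \<C> a. interior_separated X x y A B" if "?P \<in> \<C> a" for a
          using that by (intro bexI[of _ ?P]) (simp_all add: case_prod_unfold)
        show ?thesis
        proof (cases "i < n")
          case True
          then obtain a where a: "x i = Inl a"
            using coord[OF X(1) i] FieldR(1) by blast
          obtain c where c: "y i = Inl c"
            using coord[OF X(2) i] FieldR(1)[OF True] by blast
          \<comment> \<open>The truncation bounds \<open>y i\<close> by \<open>b\<close>, so the
            smaller coordinate \<open>x i\<close>, at which the cut is made, gives an index strictly
            below \<open>b\<close>.\<close>
          have "y i \<in> F b i"
            using yK i unfolding K_def by (rule PiE_mem)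
          then have "(c, b) \<in> \<kappa>"
            using True c FieldR(2)[OF True] \<kappa>'_iff by (simp add: F_def)
          moreover have "(a, c) \<in> \<kappa>" "a \<noteq> c"
            using less a c FieldR(2)[OF True] \<kappa>'_iff by auto
          ultimately have "(a, b) \<in> \<kappa> \<and> a \<noteq> b"
            by (intro \<kappa>.less_le_trans[of a c b]) auto
          moreover have "?P \<in> \<C> a"
            unfolding \<C>_def a using True by blast
          ultimately show ?thesis
            using sep by blast
        next
          case False
          \<comment> \<open>The cuts of a successor coordinate are present at every index, so any
            index below \<open>b\<close> serves; one exists since \<open>b\<close> is not the
            least.\<close>
          obtain a where a: "(a, b) \<in> \<kappa> \<and> a \<noteq> b"
            using lim by blast
          have "i \<in> {n..<N}"
            using False i by simp
          then have "?P \<in> \<C> a"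
            unfolding \<C>_def using coord[OF X(1) i] by blast
          then show ?thesis
            using sep a by blast
        qed
      qed
      obtain i where i: "i \<in> {..<N}" "x i \<noteq> y i"
        using xK yK neq PiE_ext unfolding K_def by metis
      have "x i \<in> Field (R i)" "y i \<in> Field (R i)"
        using xK yK KX coord[OF _ i(1)] by blast+
      then consider "(x i, y i) \<in> R i" | "(y i, x i) \<in> R i"
        using ordinal_space.le_total[OF R[OF i(1)]] by blast
      then show ?thesis
      proof cases
        case 1
        show ?thesis
          by (rule main[OF xK yK i(1) 1 i(2)])
      next
        case 2
        have "\<exists>a. ((a, b) \<in> \<kappa> \<and> a \<noteq> b) \<and> (\<exists>(A, B) \<in> \<C> a. interior_separated X y x A B)"
          by (rule main[OF yK xK i(1) 2 i(2)[symmetric]])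
        then show ?thesis
          using interior_separated_sym[of X y x] by fast
      qed
    qed
  qed
  then show ?thesis
    unfolding X_eq .
qed

theorem theoremD:
  fixes \<kappa> :: "'a rel" and n :: nat and ls :: "'b rel list"
  shows "CSHP long_ray \<and> CSHP long_line \<and>
    ((Card_order \<kappa> \<and> regularCard \<kappa> \<and> \<not> countable (Field \<kappa>) \<and>
      (\<forall>l \<in> set ls. successor_ordinal l \<and> (l, \<kappa>) \<in> ordLess))
     \<longrightarrow> CSHP (ordinal_product \<kappa> n ls))"
  using CSHP_long_ray CSHP_long_line CSHP_ordinal_product[of \<kappa> ls n]
  unfolding regular_uncountable_def by blast

end
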